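(* Suppose $\Gamma$ is a Lie groupoid, $\mathcal{X},\mathcal{Y}\to\mathsf{Man}$ are two categories fibered in groupoids over the category $\mathsf{Man}$ of manifolds, and $F:\mathcal{X}\to\mathcal{Y}$ is a 1-morphism of fibered categories. Then the functor $F$ induces a functor $$F_\Gamma:\mathcal{X}(\Gamma)\to\mathcal{Y}(\Gamma)$$ between cocycle categories. Moreover, if $F$ is an equivalence of categories, then so is $F_\Gamma$.
   Context: Let $\Gamma=\{\Gamma_1\rightrightarrows\Gamma_0\}$ be a Lie groupoid with source $s$ and target $t$, composition written right to left, and $\Gamma_1\times_{\Gamma_0}\Gamma_1=\{(\gamma_1,\gamma_2): s(\gamma_1)=t(\gamma_2)\}$. The face maps $d_i:\Gamma_1\times_{\Gamma_0}\Gamma_1\to\Gamma_1$ are $d_0(\gamma_1,\gamma_2)=\gamma_2$, $d_1(\gamma_1,\gamma_2)=\gamma_1\gamma_2$, $d_2(\gamma_1,\gamma_2)=\gamma_1$. For a category $\mathcal{X}\to\mathsf{Man}$ fibered in groupoids, with fiber $\mathcal{X}(M)$ over a manifold $M$, the category $\mathcal{X}(\Gamma)$ of $\Gamma$ cocycles with values in $\mathcal{X}$ (the cocycle category) has as objects pairs $(p,\varphi)$ with $p$ an object of $\mathcal{X}(\Gamma_0)$ and $\varphi:s^*p\to t^*p$ an arrow of $\mathcal{X}(\Gamma_1)$ satisfying the cocycle condition $d_2^*\varphi\circ d_0^*\varphi=d_1^*\varphi$ (modulo the canonical isomorphisms between iterated pullbacks); a morphism $(p,\varphi)\to(p',\varphi')$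 is a morphism $\alpha:p\to p'$ in $\mathcal{X}(\Gamma_0)$ with $\varphi'\circ s^*\alpha=t^*\alpha\circ\varphi$. Here pullbacks of objects of $\mathcal{X}$ along smooth maps are defined up to canonical isomorphism. A 1-morphism of categories fibered in groupoids over $\mathsf{Man}$ is a functor commuting with the projections to $\mathsf{Man}$. *)

theory Defs
  imports "HOL-Analysis.Analysis"
begin

record ('o, 'a) cat =
  Ob :: "'o set"
  Ar :: "'a set"
  src :: "'a \<Rightarrow> 'o"
  tgt :: "'a \<Rightarrow> 'o"
  ide :: "'o \<Rightarrow> 'a"
  cmp :: "'a \<Rightarrow> 'a \<Rightarrow> 'a"

text \<open>Composition is written from right to left: \<open>cmp C g f\<close> is ``first \<open>f\<close>, then \<open>g\<close>''.\<close>

definition hom :: "('o, 'a, 'r) cat_scheme \<Rightarrow> 'o \<Rightarrow> 'o \<Rightarrow> 'a set" where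
  "hom C x y = {f \<in> Ar C. src C f = x \<and> tgt C f = y}"

definition is_category :: "('o, 'a) cat \<Rightarrow> bool" where
  "is_category C \<longleftrightarrow>
     (\<forall>f \<in> Ar C. src C f \<in> Ob C \<and> tgt C f \<in> Ob C) \<and>
     (\<forall>x \<in> Ob C. ide C x \<in> hom C x x) \<and>
     (\<forall>f \<in> Ar C. \<forall>g \<in> Ar C. src C g = tgt C f \<longrightarrow> cmp C g f \<in> hom C (src C f) (tgt C g)) \<and>
     (\<forall>f \<in> Ar C. cmp C f (ide C (src C f)) = f \<and> cmp C (ide C (tgt C f)) f = f) \<and>
     (\<forall>f \<in> Ar C. \<forall>g \<in> Ar C. \<forall>h \<in> Ar C. src C g = tgt C f \<and> src C h = tgt C g \<longrightarrow>
        cmp C h (cmp C g f) = cmp C (cmp C h g) f)"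

definition is_iso :: "('o, 'a) cat \<Rightarrow> 'a \<Rightarrow> bool" where
  "is_iso C f \<longleftrightarrow> f \<in> Ar C \<and>
     (\<exists>g \<in> hom C (tgt C f) (src C f). cmp C g f = ide C (src C f) \<and> cmp C f g = ide C (tgt C f))"

record ('o, 'a, 'p, 'b) func =
  fob :: "'o \<Rightarrow> 'p"
  far :: "'a \<Rightarrow> 'b"

definition is_functor :: "('o, 'a) cat \<Rightarrow> ('p, 'b) cat \<Rightarrow> ('o, 'a, 'p, 'b) func \<Rightarrow> bool" where
  "is_functor C D F \<longleftrightarrow> is_category C \<and> is_category D \<and>
     (\<forall>x \<in> Ob C. fob F x \<in> Ob D) \<and>
     (\<forall>f \<in> Ar C. far F f \<in> hom D (fob F (src C f)) (fob F (tgt C f))) \<and>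
     (\<forall>x \<in> Ob C. far F (ide C x) = ide D (fob F x)) \<and>
     (\<forall>f \<in> Ar C. \<forall>g \<in> Ar C. src C g = tgt C f \<longrightarrow>
        far F (cmp C g f) = cmp D (far F g) (far F f))"

definition id_func :: "('o, 'a, 'o, 'a) func" where
  "id_func = \<lparr>fob = (\<lambda>x. x), far = (\<lambda>f. f)\<rparr>"

definition comp_func ::
    "('p, 'b, 'q, 'c) func \<Rightarrow> ('o, 'a, 'p, 'b) func \<Rightarrow> ('o, 'a, 'q, 'c) func" where
  "comp_func G F = \<lparr>fob = (\<lambda>x. fob G (fob F x)), far = (\<lambda>f. far G (far F f))\<rparr>"

definition is_nat_iso :: "('o, 'a) cat \<Rightarrow> ('p, 'b) cat \<Rightarrow>
    ('o, 'a, 'p, 'b) func \<Rightarrow> ('o, 'a, 'p, 'b) func \<Rightarrow> ('o \<Rightarrow> 'b) \<Rightarrow> bool" where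
  "is_nat_iso C D F G \<eta> \<longleftrightarrow> is_functor C D F \<and> is_functor C D G \<and>
     (\<forall>x \<in> Ob C. \<eta> x \<in> hom D (fob F x) (fob G x) \<and> is_iso D (\<eta> x)) \<and>
     (\<forall>f \<in> Ar C. cmp D (far G f) (\<eta> (src C f)) = cmp D (\<eta> (tgt C f)) (far F f))"

definition is_equivalence ::
    "('o, 'a) cat \<Rightarrow> ('p, 'b) cat \<Rightarrow> ('o, 'a, 'p, 'b) func \<Rightarrow> bool" where
  "is_equivalence C D F \<longleftrightarrow> is_functor C D F \<and>
     (\<exists>G. is_functor D C G \<and>
        (\<exists>\<eta>. is_nat_iso C C id_func (comp_func G F) \<eta>) \<and>
        (\<exists>\<epsilon>. is_nat_iso D D (comp_func F G) id_func \<epsilon>))"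


text \<open>The dimension has to vary, so \<open>\<real>\<^sup>n\<close> is the space \<^const>\<open>Euclidean_space\<close> \<open>n\<close> of sequences
  vanishing from index \<open>n\<close> on. A function on an open \<open>U\<close> is \<open>C\<^sup>k\<close> if all its
  iterated partial derivatives up to order \<open>k\<close> exist and are continuous on \<open>U\<close>.\<close>

definition partial :: "nat \<Rightarrow> ((nat \<Rightarrow> real) \<Rightarrow> real) \<Rightarrow> (nat \<Rightarrow> real) \<Rightarrow> real" where
  "partial i f x = deriv (\<lambda>h. f (x(i := h))) (x i)"

fun Ck_on :: "nat \<Rightarrow> nat \<Rightarrow> (nat \<Rightarrow> real) set \<Rightarrow> ((nat \<Rightarrow> real) \<Rightarrow> real) \<Rightarrow> bool" where
  "Ck_on n 0 U f \<longleftrightarrow> continuous_map (subtopology (Euclidean_space n) U) euclideanreal f"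
| "Ck_on n (Suc k) U f \<longleftrightarrow>
     continuous_map (subtopology (Euclidean_space n) U) euclideanreal f \<and>
     (\<forall>i<n. (\<forall>x\<in>U. (\<lambda>h. f (x(i := h))) differentiable (at (x i))) \<and> Ck_on n k U (partial i f))"

definition smooth_on ::
    "nat \<Rightarrow> nat \<Rightarrow> (nat \<Rightarrow> real) set \<Rightarrow> ((nat \<Rightarrow> real) \<Rightarrow> (nat \<Rightarrow> real)) \<Rightarrow> bool" where
  "smooth_on n m U f \<longleftrightarrow> openin (Euclidean_space n) U \<and>
     f ` U \<subseteq> topspace (Euclidean_space m) \<and>
     (\<forall>j<m. \<forall>k. Ck_on n k U (\<lambda>x. f x j))"


text \<open>A chart is an open set with a coordinate map, the latter made \<^const>\<open>extensional\<close> so that a maximal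
  atlas is determined by the smooth structure.\<close>

type_synonym 'p chart = "'p set \<times> ('p \<Rightarrow> (nat \<Rightarrow> real))"

definition is_chart :: "'p topology \<Rightarrow> nat \<Rightarrow> 'p chart \<Rightarrow> bool" where
  "is_chart T n = (\<lambda>(U, \<phi>). openin T U \<and> \<phi> \<in> extensional U \<and>
     openin (Euclidean_space n) (\<phi> ` U) \<and>
     homeomorphic_map (subtopology T U) (subtopology (Euclidean_space n) (\<phi> ` U)) \<phi>)"

definition compatible :: "nat \<Rightarrow> 'p chart \<Rightarrow> 'p chart \<Rightarrow> bool" where
  "compatible n = (\<lambda>(U, \<phi>) (V, \<psi>).
     smooth_on n n (\<phi> ` (U \<inter> V)) (\<psi> \<circ> inv_into U \<phi>) \<and>
     smooth_on n n (\<psi> ` (U \<inter> V)) (\<phi> \<circ> inv_into V \<psi>))"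

record 'p mfd =
  mtop :: "'p topology"
  mdim :: nat
  atlas :: "'p chart set"

abbreviation carrier :: "'p mfd \<Rightarrow> 'p set" where
  "carrier M \<equiv> topspace (mtop M)"

definition manifold :: "'p mfd \<Rightarrow> bool" where
  "manifold M \<longleftrightarrow> Hausdorff_space (mtop M) \<and> second_countable (mtop M) \<and>
     (\<forall>c \<in> atlas M. is_chart (mtop M) (mdim M) c) \<and>
     (\<forall>x \<in> carrier M. \<exists>(U, \<phi>) \<in> atlas M. x \<in> U) \<and>
     (\<forall>c \<in> atlas M. \<forall>c' \<in> atlas M. compatible (mdim M) c c') \<and>
     (\<forall>c. is_chart (mtop M) (mdim M) c \<and> (\<forall>c' \<in> atlas M. compatible (mdim M) c c')
        \<longrightarrow> c \<in> atlas M)"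

definition smooth_map :: "'p mfd \<Rightarrow> 'q mfd \<Rightarrow> ('p \<Rightarrow> 'q) \<Rightarrow> bool" where
  "smooth_map M N f \<longleftrightarrow> f ` carrier M \<subseteq> carrier N \<and>
     (\<forall>x \<in> carrier M. \<exists>(U, \<phi>) \<in> atlas M. \<exists>(V, \<psi>) \<in> atlas N.
        x \<in> U \<and> f ` U \<subseteq> V \<and>
        smooth_on (mdim M) (mdim N) (\<phi> ` U) (\<psi> \<circ> f \<circ> inv_into U \<phi>))"

text \<open>A submersion is a smooth map whose differential, in local coordinates the Jacobian matrix, is
  surjective at every point.\<close>

definition submersion :: "'p mfd \<Rightarrow> 'q mfd \<Rightarrow> ('p \<Rightarrow> 'q) \<Rightarrow> bool" where
  "submersion M N f \<longleftrightarrow> smooth_map M N f \<and>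
     (\<forall>x \<in> carrier M. \<forall>(U, \<phi>) \<in> atlas M. \<forall>(V, \<psi>) \<in> atlas N. x \<in> U \<and> f x \<in> V \<longrightarrow>
        (\<forall>w :: nat \<Rightarrow> real. \<exists>v :: nat \<Rightarrow> real. \<forall>j < mdim N.
           (\<Sum>i < mdim M. partial i (\<lambda>y. (\<psi> \<circ> f \<circ> inv_into U \<phi>) y j) (\<phi> x) * v i) = w j))"

text \<open>The points of manifolds are drawn from an arbitrary type closed under formation of ordered pairs, so that
  the fibre product of two manifolds can again live on a set of pairs. For \<open>'a = real\<close>
  every manifold is diffeomorphic to one of this form, since its cardinality is at most that
  of the continuum.\<close>

datatype 'a pt = Atom 'a | Couple (fst_pt: "'a pt") (snd_pt: "'a pt")

text \<open>An arrow is a triple \<open>(M, f, N)\<close>, with \<open>f\<close> undefined off \<open>M\<close>.\<close>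

type_synonym 'a man_arrow = "'a pt mfd \<times> ('a pt \<Rightarrow> 'a pt) \<times> 'a pt mfd"

definition Man :: "('a pt mfd, 'a man_arrow) cat" where
  "Man = \<lparr>Ob = {M. manifold M},
     Ar = {(M, f, N). manifold M \<and> manifold N \<and> smooth_map M N f \<and> f \<in> extensional (carrier M)},
     src = (\<lambda>(M, f, N). M),
     tgt = (\<lambda>(M, f, N). N),
     ide = (\<lambda>M. (M, restrict (\<lambda>x. x) (carrier M), M)),
     cmp = (\<lambda>(N', g, P) (M, f, N). (M, compose (carrier M) g f, P))\<rparr>"

definition man_arr :: "'a pt mfd \<Rightarrow> 'a pt mfd \<Rightarrow> ('a pt \<Rightarrow> 'a pt) \<Rightarrow> 'a man_arrow" where
  "man_arr M N f = (M, restrict f (carrier M), N)"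

text \<open>The fibre product of \<open>f : M \<rightarrow> B\<close> and \<open>g : N \<rightarrow> B\<close>: the usual set of pairs, whose
  smooth structure is pinned down by the universal property in the category of manifolds.\<close>

definition is_fibre_product :: "'a pt mfd \<Rightarrow> 'a pt mfd \<Rightarrow>
    ('a pt \<Rightarrow> 'a pt) \<Rightarrow> ('a pt \<Rightarrow> 'a pt) \<Rightarrow> 'a pt mfd \<Rightarrow> bool" where
  "is_fibre_product M N f g P \<longleftrightarrow> manifold P \<and>
     carrier P = {Couple x y | x y. x \<in> carrier M \<and> y \<in> carrier N \<and> f x = g y} \<and>
     smooth_map P M fst_pt \<and> smooth_map P N snd_pt \<and>
     (\<forall>Q a b. manifold (Q :: 'a pt mfd) \<and> smooth_map Q M a \<and> smooth_map Q N b \<and>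
        (\<forall>q \<in> carrier Q. f (a q) = g (b q)) \<longrightarrow> smooth_map Q P (\<lambda>q. Couple (a q) (b q)))"


text \<open>\<open>G2\<close> is the manifold of composable pairs. It is determined by the other data, and exists
  because source and target are submersions.\<close>

record 'a groupoid =
  G0 :: "'a pt mfd"
  G1 :: "'a pt mfd"
  G2 :: "'a pt mfd"
  gsrc :: "'a pt \<Rightarrow> 'a pt"
  gtgt :: "'a pt \<Rightarrow> 'a pt"
  gmul :: "'a pt \<Rightarrow> 'a pt \<Rightarrow> 'a pt"
  gunit :: "'a pt \<Rightarrow> 'a pt"
  ginv :: "'a pt \<Rightarrow> 'a pt"

definition lie_groupoid :: "'a groupoid \<Rightarrow> bool" where
  "lie_groupoid \<Gamma> \<longleftrightarrow>
     manifold (G0 \<Gamma>) \<and> manifold (G1 \<Gamma>) \<and>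
     submersion (G1 \<Gamma>) (G0 \<Gamma>) (gsrc \<Gamma>) \<and> gsrc \<Gamma> ` carrier (G1 \<Gamma>) = carrier (G0 \<Gamma>) \<and>
     submersion (G1 \<Gamma>) (G0 \<Gamma>) (gtgt \<Gamma>) \<and> gtgt \<Gamma> ` carrier (G1 \<Gamma>) = carrier (G0 \<Gamma>) \<and>
     is_fibre_product (G1 \<Gamma>) (G1 \<Gamma>) (gsrc \<Gamma>) (gtgt \<Gamma>) (G2 \<Gamma>) \<and>
     smooth_map (G2 \<Gamma>) (G1 \<Gamma>) (\<lambda>z. gmul \<Gamma> (fst_pt z) (snd_pt z)) \<and>
     smooth_map (G0 \<Gamma>) (G1 \<Gamma>) (gunit \<Gamma>) \<and>
     smooth_map (G1 \<Gamma>) (G1 \<Gamma>) (ginv \<Gamma>) \<and>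
     (\<forall>a \<in> carrier (G1 \<Gamma>). \<forall>b \<in> carrier (G1 \<Gamma>). gsrc \<Gamma> a = gtgt \<Gamma> b \<longrightarrow>
        gsrc \<Gamma> (gmul \<Gamma> a b) = gsrc \<Gamma> b \<and> gtgt \<Gamma> (gmul \<Gamma> a b) = gtgt \<Gamma> a) \<and>
     (\<forall>a \<in> carrier (G1 \<Gamma>). \<forall>b \<in> carrier (G1 \<Gamma>). \<forall>c \<in> carrier (G1 \<Gamma>).
        gsrc \<Gamma> a = gtgt \<Gamma> b \<and> gsrc \<Gamma> b = gtgt \<Gamma> c \<longrightarrow>
        gmul \<Gamma> a (gmul \<Gamma> b c) = gmul \<Gamma> (gmul \<Gamma> a b) c) \<and>
     (\<forall>x \<in> carrier (G0 \<Gamma>). gsrc \<Gamma> (gunit \<Gamma> x) = x \<and> gtgt \<Gamma> (gunit \<Gamma> x) = x) \<and>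
     (\<forall>a \<in> carrier (G1 \<Gamma>).
        gmul \<Gamma> a (gunit \<Gamma> (gsrc \<Gamma> a)) = a \<and> gmul \<Gamma> (gunit \<Gamma> (gtgt \<Gamma> a)) a = a) \<and>
     (\<forall>a \<in> carrier (G1 \<Gamma>).
        gsrc \<Gamma> (ginv \<Gamma> a) = gtgt \<Gamma> a \<and> gtgt \<Gamma> (ginv \<Gamma> a) = gsrc \<Gamma> a \<and>
        gmul \<Gamma> (ginv \<Gamma> a) a = gunit \<Gamma> (gsrc \<Gamma> a) \<and>
        gmul \<Gamma> a (ginv \<Gamma> a) = gunit \<Gamma> (gtgt \<Gamma> a))"

definition s_arr :: "'a groupoid \<Rightarrow> 'a man_arrow" where
  "s_arr \<Gamma> = man_arr (G1 \<Gamma>) (G0 \<Gamma>) (gsrc \<Gamma>)"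

definition t_arr :: "'a groupoid \<Rightarrow> 'a man_arrow" where
  "t_arr \<Gamma> = man_arr (G1 \<Gamma>) (G0 \<Gamma>) (gtgt \<Gamma>)"

definition d0 :: "'a groupoid \<Rightarrow> 'a man_arrow" where
  "d0 \<Gamma> = man_arr (G2 \<Gamma>) (G1 \<Gamma>) snd_pt"

definition d1 :: "'a groupoid \<Rightarrow> 'a man_arrow" where
  "d1 \<Gamma> = man_arr (G2 \<Gamma>) (G1 \<Gamma>) (\<lambda>z. gmul \<Gamma> (fst_pt z) (snd_pt z))"

definition d2 :: "'a groupoid \<Rightarrow> 'a man_arrow" where
  "d2 \<Gamma> = man_arr (G2 \<Gamma>) (G1 \<Gamma>) fst_pt"


text \<open>\<open>\<pi>\<close> is the projection of \<open>X\<close> to the base category \<open>B\<close>. Every arrow of \<open>B\<close> has a lift with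
  prescribed target, and every arrow of \<open>X\<close> is cartesian.\<close>

definition fibered_in_groupoids ::
    "('m, 'n) cat \<Rightarrow> ('o, 'a) cat \<Rightarrow> ('o, 'a, 'm, 'n) func \<Rightarrow> bool" where
  "fibered_in_groupoids B X \<pi> \<longleftrightarrow> is_functor X B \<pi> \<and>
     (\<forall>x \<in> Ob X. \<forall>f \<in> Ar B. tgt B f = fob \<pi> x \<longrightarrow>
        (\<exists>a \<in> Ar X. tgt X a = x \<and> far \<pi> a = f)) \<and>
     (\<forall>a \<in> Ar X. \<forall>b \<in> Ar X. tgt X a = tgt X b \<longrightarrow>
        (\<forall>k \<in> hom B (fob \<pi> (src X a)) (fob \<pi> (src X b)). cmp B (far \<pi> b) k = far \<pi> a \<longrightarrow>
           (\<exists>!c. c \<in> hom X (src X a) (src X b) \<and> far \<pi> c = k \<and> cmp X b c = a)))"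

definition fibered_1_morphism :: "('m, 'n) cat \<Rightarrow>
    ('o, 'a) cat \<Rightarrow> ('o, 'a, 'm, 'n) func \<Rightarrow> ('p, 'b) cat \<Rightarrow> ('p, 'b, 'm, 'n) func \<Rightarrow>
    ('o, 'a, 'p, 'b) func \<Rightarrow> bool" where
  "fibered_1_morphism B X \<pi> Y \<pi>' F \<longleftrightarrow> is_functor X Y F \<and>
     (\<forall>x \<in> Ob X. fob \<pi>' (fob F x) = fob \<pi> x) \<and>
     (\<forall>a \<in> Ar X. far \<pi>' (far F a) = far \<pi> a)"

definition fibre :: "('m, 'n) cat \<Rightarrow> ('o, 'a) cat \<Rightarrow> ('o, 'a, 'm, 'n) func \<Rightarrow> 'm \<Rightarrow> ('o, 'a) cat" where
  "fibre B X \<pi> M = \<lparr>Ob = {x \<in> Ob X. fob \<pi> x = M},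
     Ar = {a \<in> Ar X. fob \<pi> (src X a) = M \<and> fob \<pi> (tgt X a) = M \<and> far \<pi> a = ide B M},
     src = src X, tgt = tgt X, ide = ide X, cmp = cmp X\<rparr>"

text \<open>A choice of pullbacks: \<open>\<kappa> x f\<close> is the chosen arrow \<open>f\<^sup>*x \<rightarrow> x\<close> over \<open>f\<close>.\<close>

definition is_cleavage :: "('m, 'n) cat \<Rightarrow> ('o, 'a) cat \<Rightarrow> ('o, 'a, 'm, 'n) func \<Rightarrow>
    ('o \<Rightarrow> 'n \<Rightarrow> 'a) \<Rightarrow> bool" where
  "is_cleavage B X \<pi> \<kappa> \<longleftrightarrow>
     (\<forall>x \<in> Ob X. \<forall>f \<in> Ar B. tgt B f = fob \<pi> x \<longrightarrow>
        \<kappa> x f \<in> Ar X \<and> tgt X (\<kappa> x f) = x \<and> far \<pi> (\<kappa> x f) = f)"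

definition pull :: "('o, 'a) cat \<Rightarrow> ('o \<Rightarrow> 'n \<Rightarrow> 'a) \<Rightarrow> 'n \<Rightarrow> 'o \<Rightarrow> 'o" where
  "pull X \<kappa> f x = src X (\<kappa> x f)"

definition pull_arr :: "('m, 'n) cat \<Rightarrow> ('o, 'a) cat \<Rightarrow> ('o, 'a, 'm, 'n) func \<Rightarrow>
    ('o \<Rightarrow> 'n \<Rightarrow> 'a) \<Rightarrow> 'n \<Rightarrow> 'a \<Rightarrow> 'a" where
  "pull_arr B X \<pi> \<kappa> f \<alpha> = (THE \<beta>.
     \<beta> \<in> hom (fibre B X \<pi> (src B f)) (pull X \<kappa> f (src X \<alpha>)) (pull X \<kappa> f (tgt X \<alpha>)) \<and>
     cmp X (\<kappa> (tgt X \<alpha>) f) \<beta> = cmp X \<alpha> (\<kappa> (src X \<alpha>) f))"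

text \<open>For two arrows \<open>a\<close>, \<open>b\<close> with the same target and the same image in the base, the canonical
  isomorphism from the source of \<open>a\<close> to the source of \<open>b\<close>.\<close>

definition canon :: "('m, 'n) cat \<Rightarrow> ('o, 'a) cat \<Rightarrow> ('o, 'a, 'm, 'n) func \<Rightarrow> 'a \<Rightarrow> 'a \<Rightarrow> 'a" where
  "canon B X \<pi> a b = (THE u.
     u \<in> hom (fibre B X \<pi> (fob \<pi> (src X a))) (src X a) (src X b) \<and> cmp X b u = a)"

text \<open>The composite \<open>g\<^sup>*f\<^sup>*x \<rightarrow> f\<^sup>*x \<rightarrow> x\<close>, an arrow over \<open>f \<circ> g\<close>.\<close>

definition lift2 :: "('o, 'a) cat \<Rightarrow> ('o \<Rightarrow> 'n \<Rightarrow> 'a) \<Rightarrow> 'o \<Rightarrow> 'n \<Rightarrow> 'n \<Rightarrow> 'a" where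
  "lift2 X \<kappa> x f g = cmp X (\<kappa> x f) (\<kappa> (pull X \<kappa> f x) g)"


text \<open>Both sides of the cocycle condition are read as arrows \<open>d\<^sub>0\<^sup>*s\<^sup>*p \<rightarrow> d\<^sub>2\<^sup>*t\<^sup>*p\<close>, with the canonical
  isomorphisms \<open>d\<^sub>0\<^sup>*t\<^sup>*p \<cong> d\<^sub>2\<^sup>*s\<^sup>*p\<close>, \<open>d\<^sub>0\<^sup>*s\<^sup>*p \<cong> d\<^sub>1\<^sup>*s\<^sup>*p\<close> and \<open>d\<^sub>1\<^sup>*t\<^sup>*p \<cong> d\<^sub>2\<^sup>*t\<^sup>*p\<close> inserted.\<close>

definition is_cocycle :: "'m groupoid \<Rightarrow> ('o, 'a) cat \<Rightarrow>
    ('o, 'a, 'm pt mfd, 'm man_arrow) func \<Rightarrow> ('o \<Rightarrow> 'm man_arrow \<Rightarrow> 'a) \<Rightarrow> 'o \<times> 'a \<Rightarrow> bool" where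
  "is_cocycle \<Gamma> X \<pi> \<kappa> = (\<lambda>(p, \<phi>).
     let s = s_arr \<Gamma>; t = t_arr \<Gamma>; d0 = d0 \<Gamma>; d1 = d1 \<Gamma>; d2 = d2 \<Gamma>;
         pb = pull_arr Man X \<pi> \<kappa>; c = canon Man X \<pi>; l = lift2 X \<kappa> p
     in p \<in> Ob (fibre Man X \<pi> (G0 \<Gamma>)) \<and>
        \<phi> \<in> hom (fibre Man X \<pi> (G1 \<Gamma>)) (pull X \<kappa> s p) (pull X \<kappa> t p) \<and>
        cmp X (pb d2 \<phi>) (cmp X (c (l t d0) (l s d2)) (pb d0 \<phi>)) =
        cmp X (c (l t d1) (l t d2)) (cmp X (pb d1 \<phi>) (c (l s d0) (l s d1))))"

text \<open>An arrow carries its source and target, since the same \<open>\<alpha>\<close> can be a morphism between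
  different pairs of cocycles.\<close>

definition cocycle_cat :: "'m groupoid \<Rightarrow> ('o, 'a) cat \<Rightarrow>
    ('o, 'a, 'm pt mfd, 'm man_arrow) func \<Rightarrow> ('o \<Rightarrow> 'm man_arrow \<Rightarrow> 'a) \<Rightarrow>
    ('o \<times> 'a, ('o \<times> 'a) \<times> 'a \<times> ('o \<times> 'a)) cat" where
  "cocycle_cat \<Gamma> X \<pi> \<kappa> = \<lparr>
     Ob = {z. is_cocycle \<Gamma> X \<pi> \<kappa> z},
     Ar = {((p, \<phi>), \<alpha>, (p', \<phi>')).
             is_cocycle \<Gamma> X \<pi> \<kappa> (p, \<phi>) \<and> is_cocycle \<Gamma> X \<pi> \<kappa> (p', \<phi>') \<and>
             \<alpha> \<in> hom (fibre Man X \<pi> (G0 \<Gamma>)) p p' \<and>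
             cmp X \<phi>' (pull_arr Man X \<pi> \<kappa> (s_arr \<Gamma>) \<alpha>) =
             cmp X (pull_arr Man X \<pi> \<kappa> (t_arr \<Gamma>) \<alpha>) \<phi>},
     src = (\<lambda>(z, \<alpha>, z'). z),
     tgt = (\<lambda>(z, \<alpha>, z'). z'),
     ide = (\<lambda>(p, \<phi>). ((p, \<phi>), ide X p, (p, \<phi>))),
     cmp = (\<lambda>(w, \<beta>, w') (z, \<alpha>, z'). (z, cmp X \<beta> \<alpha>, w'))\<rparr>"

text \<open>The functor induced by \<open>F\<close> sends \<open>(p, \<phi>)\<close> to \<open>F p\<close> with
  \<open>s\<^sup>*(F p) \<cong> F(s\<^sup>*p) \<rightarrow> F(t\<^sup>*p) \<cong> t\<^sup>*(F p)\<close>, the middle arrow being \<open>F \<phi>\<close>, and \<open>\<alpha>\<close> to \<open>F \<alpha>\<close>.\<close>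

definition cocycle_ob :: "'m groupoid \<Rightarrow> ('o \<Rightarrow> 'm man_arrow \<Rightarrow> 'a) \<Rightarrow> ('p, 'b) cat \<Rightarrow>
    ('p, 'b, 'm pt mfd, 'm man_arrow) func \<Rightarrow> ('p \<Rightarrow> 'm man_arrow \<Rightarrow> 'b) \<Rightarrow>
    ('o, 'a, 'p, 'b) func \<Rightarrow> 'o \<times> 'a \<Rightarrow> 'p \<times> 'b" where
  "cocycle_ob \<Gamma> \<kappa> Y \<pi>' \<kappa>' F = (\<lambda>(p, \<phi>).
     (fob F p,
      cmp Y (canon Man Y \<pi>' (far F (\<kappa> p (t_arr \<Gamma>))) (\<kappa>' (fob F p) (t_arr \<Gamma>)))
        (cmp Y (far F \<phi>)
          (canon Man Y \<pi>' (\<kappa>' (fob F p) (s_arr \<Gamma>)) (far F (\<kappa> p (s_arr \<Gamma>)))))))"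

definition cocycle_func :: "'m groupoid \<Rightarrow> ('o \<Rightarrow> 'm man_arrow \<Rightarrow> 'a) \<Rightarrow> ('p, 'b) cat \<Rightarrow>
    ('p, 'b, 'm pt mfd, 'm man_arrow) func \<Rightarrow> ('p \<Rightarrow> 'm man_arrow \<Rightarrow> 'b) \<Rightarrow>
    ('o, 'a, 'p, 'b) func \<Rightarrow>
    ('o \<times> 'a, ('o \<times> 'a) \<times> 'a \<times> ('o \<times> 'a), 'p \<times> 'b, ('p \<times> 'b) \<times> 'b \<times> ('p \<times> 'b)) func" where
  "cocycle_func \<Gamma> \<kappa> Y \<pi>' \<kappa>' F =
     \<lparr>fob = cocycle_ob \<Gamma> \<kappa> Y \<pi>' \<kappa>' F,
      far = (\<lambda>(z, \<alpha>, z'). (cocycle_ob \<Gamma> \<kappa> Y \<pi>' \<kappa>' F z, far F \<alpha>, cocycle_ob \<Gamma> \<kappa> Y \<pi>' \<kappa>' F z'))\<rparr>"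

end

theory Submission
  imports Defs
begin

text \<open>A cocycle \<open>(p, \<phi>)\<close> amounts to a pair of arrows \<open>\<sigma>, \<rho> : s\<^sup>*p \<rightarrow> p\<close> over the source and target maps
  of \<open>\<Gamma>\<close>. In these terms the cocycle condition and the morphisms no longer mention pullbacks along the
  face maps or canonical isomorphisms: since every arrow of \<open>X\<close> is cartesian, the condition can be
  tested on a single triple of arrows over \<open>d\<^sub>0, d\<^sub>1, d\<^sub>2\<close> with common source. Hence \<open>F\<close> preserves
  cocycles, reflects them if it is faithful, and the cocycle \<open>F\<^sub>\<Gamma>(p, \<phi>)\<close> is isomorphic, as a span, to
  \<open>(F \<sigma>, F \<rho>)\<close>. If \<open>F\<close> is fully faithful and essentially surjective, then cocycles and their morphisms
  lift along \<open>F\<close>, so \<open>F\<^sub>\<Gamma>\<close> is fully faithful and essentially surjective as well.\<close>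

section \<open>Categories and equivalences\<close>

text \<open>An equivalence comes with a quasi-inverse that is an arbitrary functor: it need not
  commute with the projections to \<open>Man\<close>, and its unit and counit need not be vertical.
  So the passage to cocycles cannot simply be applied to the quasi-inverse. Faithfulness, fullness
  and essential surjectivity involve \<open>F\<close> alone; they are carried over to the cocycle
  categories, and a new quasi-inverse is chosen there.

  A second obstacle is that the cleavages of \<open>X\<close> and \<open>Y\<close> are unrelated, so
  \<open>F\<close> takes a chosen pullback only to some pullback. Spans with an arbitrary apex
  absorb this: the image of a span is again a span, and the chosen pullbacks return only through
  vertical comparison arrows. The legs attached to (p, \<phi>) are the chosen arrow s^*p -> p and
  the composite of \<phi> with the chosen arrow t^*p -> p.\<close>

locale category =
  fixes C :: "('o, 'a) cat"
  assumes is_category: "is_category C"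
begin

lemma src_Ob [simp]: "f \<in> Ar C \<Longrightarrow> src C f \<in> Ob C"
  and tgt_Ob [simp]: "f \<in> Ar C \<Longrightarrow> tgt C f \<in> Ob C"
  using is_category by (auto simp: is_category_def)

lemma cmp_Ar [simp]: "f \<in> Ar C \<Longrightarrow> g \<in> Ar C \<Longrightarrow> src C g = tgt C f \<Longrightarrow> cmp C g f \<in> Ar C"
  and src_cmp [simp]: "f \<in> Ar C \<Longrightarrow> g \<in> Ar C \<Longrightarrow> src C g = tgt C f \<Longrightarrow> src C (cmp C g f) = src C f"
  and tgt_cmp [simp]: "f \<in> Ar C \<Longrightarrow> g \<in> Ar C \<Longrightarrow> src C g = tgt C f \<Longrightarrow> tgt C (cmp C g f) = tgt C g"
  using is_category by (auto simp: is_category_def hom_def)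

lemma ide_Ar [simp]: "x \<in> Ob C \<Longrightarrow> ide C x \<in> Ar C"
  and src_ide [simp]: "x \<in> Ob C \<Longrightarrow> src C (ide C x) = x"
  and tgt_ide [simp]: "x \<in> Ob C \<Longrightarrow> tgt C (ide C x) = x"
  using is_category by (auto simp: is_category_def hom_def)

lemma cmp_ide_right [simp]: "f \<in> Ar C \<Longrightarrow> src C f = x \<Longrightarrow> cmp C f (ide C x) = f"
  and cmp_ide_left [simp]: "f \<in> Ar C \<Longrightarrow> tgt C f = x \<Longrightarrow> cmp C (ide C x) f = f"
  using is_category by (auto simp: is_category_def)

lemma assoc: "f \<in> Ar C \<Longrightarrow> g \<in> Ar C \<Longrightarrow> h \<in> Ar C \<Longrightarrow> src C g = tgt C f \<Longrightarrow> src C h = tgt C g \<Longrightarrow>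
    cmp C (cmp C h g) f = cmp C h (cmp C g f)"
  using is_category by (simp add: is_category_def)

lemma is_isoE:
  assumes "is_iso C f"
  obtains g where "g \<in> Ar C" "src C g = tgt C f" "tgt C g = src C f"
    "cmp C g f = ide C (src C f)" "cmp C f g = ide C (tgt C f)"
  using assms by (auto simp: is_iso_def hom_def)

lemma is_isoI:
  assumes "f \<in> Ar C" "g \<in> Ar C" "src C g = tgt C f" "tgt C g = src C f"
    "cmp C g f = ide C (src C f)" "cmp C f g = ide C (tgt C f)"
  shows "is_iso C f"
  using assms by (auto simp: is_iso_def hom_def)

lemma iso_cancel_left:
  assumes "is_iso C e" "f \<in> Ar C" "g \<in> Ar C" "tgt C f = src C e" "tgt C g = src C e"
    and eq: "cmp C e f = cmp C e g"
  shows "f = g"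
proof -
  obtain d where d: "d \<in> Ar C" "src C d = tgt C e" "tgt C d = src C e" "cmp C d e = ide C (src C e)"
    using is_isoE[OF assms(1)] by metis
  have e: "e \<in> Ar C" using assms(1) by (simp add: is_iso_def)
  have "cmp C (cmp C d e) f = cmp C (cmp C d e) g"
    using assms(2-5) d(1-3) e eq by (simp add: assoc)
  then show ?thesis using assms d(4) by simp
qed

lemma iso_cancel_right:
  assumes "is_iso C e" "f \<in> Ar C" "g \<in> Ar C" "src C f = tgt C e" "src C g = tgt C e"
    and eq: "cmp C f e = cmp C g e"
  shows "f = g"
proof -
  obtain d where d: "d \<in> Ar C" "src C d = tgt C e" "tgt C d = src C e" "cmp C e d = ide C (tgt C e)"
    using is_isoE[OF assms(1)] by metis
  have e: "e \<in> Ar C" using assms(1) by (simp add: is_iso_def)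
  have "cmp C f (cmp C e d) = cmp C g (cmp C e d)"
    using assms(2-5) d(1-3) e eq by (simp add: assoc[symmetric])
  then show ?thesis using assms d(4) by simp
qed

end

locale cat_functor =
  fixes C :: "('o, 'a) cat" and D :: "('p, 'b) cat" and F :: "('o, 'a, 'p, 'b) func"
  assumes is_functor: "is_functor C D F"
begin

sublocale dom: category C
  using is_functor by unfold_locales (simp add: is_functor_def)

sublocale cod: category D
  using is_functor by unfold_locales (simp add: is_functor_def)

lemma fob_Ob [simp]: "x \<in> Ob C \<Longrightarrow> fob F x \<in> Ob D"
  using is_functor by (simp add: is_functor_def)

lemma far_Ar [simp]: "f \<in> Ar C \<Longrightarrow> far F f \<in> Ar D"
  and src_far [simp]: "f \<in> Ar C \<Longrightarrow> src D (far F f) = fob F (src C f)"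
  and tgt_far [simp]: "f \<in> Ar C \<Longrightarrow> tgt D (far F f) = fob F (tgt C f)"
  using is_functor by (auto simp: is_functor_def hom_def)

lemma far_ide [simp]: "x \<in> Ob C \<Longrightarrow> far F (ide C x) = ide D (fob F x)"
  using is_functor by (simp add: is_functor_def)

lemma far_cmp [simp]: "f \<in> Ar C \<Longrightarrow> g \<in> Ar C \<Longrightarrow> src C g = tgt C f \<Longrightarrow>
    far F (cmp C g f) = cmp D (far F g) (far F f)"
  using is_functor by (simp add: is_functor_def)

end

section \<open>Equivalences are fully faithful and essentially surjective\<close>

definition faithful :: "('o, 'a) cat \<Rightarrow> ('o, 'a, 'p, 'b) func \<Rightarrow> bool" where
  "faithful C F \<longleftrightarrow> (\<forall>f \<in> Ar C. \<forall>g \<in> Ar C. src C f = src C g \<longrightarrow> tgt C f = tgt C g \<longrightarrow>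
     far F f = far F g \<longrightarrow> f = g)"

definition full :: "('o, 'a) cat \<Rightarrow> ('p, 'b) cat \<Rightarrow> ('o, 'a, 'p, 'b) func \<Rightarrow> bool" where
  "full C D F \<longleftrightarrow> (\<forall>x \<in> Ob C. \<forall>y \<in> Ob C. \<forall>g \<in> hom D (fob F x) (fob F y). \<exists>f \<in> hom C x y. far F f = g)"

definition ess_surj :: "('o, 'a) cat \<Rightarrow> ('p, 'b) cat \<Rightarrow> ('o, 'a, 'p, 'b) func \<Rightarrow> bool" where
  "ess_surj C D F \<longleftrightarrow> (\<forall>y \<in> Ob D. \<exists>x \<in> Ob C. \<exists>e \<in> hom D (fob F x) y. is_iso D e)"

lemma faithfulD:
  "faithful C F \<Longrightarrow> f \<in> Ar C \<Longrightarrow> g \<in> Ar C \<Longrightarrow> src C f = src C g \<Longrightarrow> tgt C f = tgt C g \<Longrightarrow>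
     far F f = far F g \<Longrightarrow> f = g"
  by (auto simp: faithful_def)

lemma fullE:
  assumes "full C D F" "x \<in> Ob C" "y \<in> Ob C" "g \<in> Ar D" "src D g = fob F x" "tgt D g = fob F y"
  obtains f where "f \<in> Ar C" "src C f = x" "tgt C f = y" "far F f = g"
  using assms by (fastforce simp: full_def hom_def)

lemma equivalence_imp_faithful:
  assumes "is_equivalence C D F"
  shows "faithful C F"
proof -
  obtain G \<eta> where G: "is_functor D C G" and \<eta>: "is_nat_iso C C id_func (comp_func G F) \<eta>"
    using assms by (auto simp: is_equivalence_def)
  interpret F: cat_functor C D F
    using assms by unfold_locales (simp add: is_equivalence_def)
  interpret G: cat_functor D C G
    using G by unfold_locales
  show ?thesis
    unfolding faithful_def
  proof (intro ballI impI)
    fix f g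
    assume fg: "f \<in> Ar C" "g \<in> Ar C" "src C f = src C g" "tgt C f = tgt C g" "far F f = far F g"
    have nat: "cmp C (far G (far F h)) (\<eta> (src C h)) = cmp C (\<eta> (tgt C h)) h" if "h \<in> Ar C" for h
      using \<eta> that by (simp add: is_nat_iso_def comp_func_def id_func_def)
    have "is_iso C (\<eta> (tgt C f))" "src C (\<eta> (tgt C f)) = tgt C f"
      using \<eta> fg(1) by (simp_all add: is_nat_iso_def id_func_def hom_def)
    moreover have "cmp C (\<eta> (tgt C f)) f = cmp C (\<eta> (tgt C f)) g"
      using nat[OF fg(1)] nat[OF fg(2)] fg by simp
    ultimately show "f = g"
      using fg F.dom.iso_cancel_left by metis
  qed
qed

text \<open>Naturality of the counit recovers \<open>f\<close> from \<open>far F (far G f)\<close>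
  up to isomorphisms, so \<open>far G f\<close> determines \<open>f\<close>. Fullness of
  \<open>F\<close> needs this, because there the equation \<open>far F f = g\<close> is first
  obtained only after applying \<open>G\<close>.\<close>

lemma equivalence_inverse_faithful:
  assumes G: "is_functor D C G" and \<epsilon>: "is_nat_iso D D (comp_func F G) id_func \<epsilon>"
  shows "faithful D G"
proof -
  interpret G: cat_functor D C G
    using G by unfold_locales
  show ?thesis
    unfolding faithful_def
  proof (intro ballI impI)
    fix f g
    assume fg: "f \<in> Ar D" "g \<in> Ar D" "src D f = src D g" "tgt D f = tgt D g" "far G f = far G g"
    have nat: "cmp D h (\<epsilon> (src D h)) = cmp D (\<epsilon> (tgt D h)) (far F (far G h))" if "h \<in> Ar D" for h
      using \<epsilon> that by (simp add: is_nat_iso_def comp_func_def id_func_def)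
    have "is_iso D (\<epsilon> (src D f))" "tgt D (\<epsilon> (src D f)) = src D f"
      using \<epsilon> fg(1) by (simp_all add: is_nat_iso_def id_func_def hom_def)
    moreover have "cmp D f (\<epsilon> (src D f)) = cmp D g (\<epsilon> (src D f))"
      using nat[OF fg(1)] nat[OF fg(2)] fg by simp
    ultimately show "f = g"
      using fg G.dom.iso_cancel_right by metis
  qed
qed

lemma equivalence_imp_full:
  assumes "is_equivalence C D F"
  shows "full C D F"
proof -
  obtain G \<eta> \<epsilon> where G: "is_functor D C G" and \<eta>: "is_nat_iso C C id_func (comp_func G F) \<eta>"
    and \<epsilon>: "is_nat_iso D D (comp_func F G) id_func \<epsilon>"
    using assms by (auto simp: is_equivalence_def)
  interpret F: cat_functor C D F
    using assms by unfold_locales (simp add: is_equivalence_def)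
  interpret G: cat_functor D C G
    using G by unfold_locales
  have \<eta>_iso: "is_iso C (\<eta> x)" and \<eta>_Ar: "\<eta> x \<in> Ar C" and \<eta>_src: "src C (\<eta> x) = x"
    and \<eta>_tgt: "tgt C (\<eta> x) = fob G (fob F x)" if "x \<in> Ob C" for x
    using \<eta> that by (simp_all add: is_nat_iso_def comp_func_def id_func_def hom_def)
  show ?thesis
    unfolding full_def
  proof (intro ballI)
    fix x y g
    assume xy: "x \<in> Ob C" "y \<in> Ob C" and "g \<in> hom D (fob F x) (fob F y)"
    then have g: "g \<in> Ar D" "src D g = fob F x" "tgt D g = fob F y"
      by (auto simp: hom_def)
    obtain i where i: "i \<in> Ar C" "src C i = fob G (fob F y)" "tgt C i = y"
      "cmp C (\<eta> y) i = ide C (fob G (fob F y))"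
      using F.dom.is_isoE[OF \<eta>_iso[OF xy(2)]] \<eta>_src[OF xy(2)] \<eta>_tgt[OF xy(2)] by metis
    \<comment> \<open>Naturality of \<eta> leaves no other candidate: a preimage \<open>f\<close> of
      \<open>g\<close> must satisfy \<open>cmp C (\<eta> y) f = cmp C (far G g) (\<eta> x)\<close>,
      and \<open>i\<close> inverts \<open>\<eta> y\<close>.\<close>
    define f where "f = cmp C i (cmp C (far G g) (\<eta> x))"
    have f: "f \<in> Ar C" "src C f = x" "tgt C f = y"
      using i g xy by (simp_all add: f_def \<eta>_Ar \<eta>_src \<eta>_tgt)
    have "cmp C (\<eta> y) f = cmp C (cmp C (\<eta> y) i) (cmp C (far G g) (\<eta> x))"
      using i(1-3) g xy by (simp add: f_def \<eta>_Ar \<eta>_src \<eta>_tgt F.dom.assoc)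
    also have "\<dots> = cmp C (far G g) (\<eta> x)"
      using i g xy by (simp add: \<eta>_Ar \<eta>_src \<eta>_tgt)
    finally have "cmp C (\<eta> y) f = cmp C (far G g) (\<eta> x)" .
    moreover have "cmp C (far G (far F f)) (\<eta> x) = cmp C (\<eta> y) f"
      using \<eta> f by (auto simp: is_nat_iso_def comp_func_def id_func_def)
    ultimately have "far G (far F f) = far G g"
      using F.dom.iso_cancel_right[OF \<eta>_iso[OF xy(1)], of "far G (far F f)" "far G g"] f g xy
      by (simp add: \<eta>_tgt)
    then have "far F f = g"
      using faithfulD[OF equivalence_inverse_faithful[OF G \<epsilon>], of "far F f" g] f g by simp
    then show "\<exists>f \<in> hom C x y. far F f = g"
      using f by (auto simp: hom_def)
  qed
qed

lemma equivalence_imp_ess_surj: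
  assumes "is_equivalence C D F"
  shows "ess_surj C D F"
  using assms
  by (fastforce simp: is_equivalence_def is_nat_iso_def is_functor_def ess_surj_def comp_func_def id_func_def)

section \<open>Fully faithful, essentially surjective functors are equivalences\<close>

context cat_functor
begin

lemma fully_faithful_reflects_iso:
  assumes ff: "faithful C F" "full C D F" and f: "f \<in> Ar C" and iso: "is_iso D (far F f)"
  shows "is_iso C f"
proof -
  obtain h where h: "h \<in> Ar D" "src D h = fob F (tgt C f)" "tgt D h = fob F (src C f)"
      "cmp D h (far F f) = ide D (fob F (src C f))" "cmp D (far F f) h = ide D (fob F (tgt C f))"
    using cod.is_isoE[OF iso] f by auto
  obtain g where g: "g \<in> Ar C" "src C g = tgt C f" "tgt C g = src C f" "far F g = h"
    using fullE[OF ff(2), of "tgt C f" "src C f" h] f h by auto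
  have "cmp C g f = ide C (src C f)" "cmp C f g = ide C (tgt C f)"
    by (rule faithfulD[OF ff(1)]; use f g h in auto)+
  with f g show ?thesis by (blast intro: dom.is_isoI)
qed

theorem fully_faithful_ess_surj_imp_equivalence:
  assumes ff: "faithful C F" "full C D F" and es: "ess_surj C D F"
  shows "is_equivalence C D F"
proof -
  have "\<forall>y \<in> Ob D. \<exists>x e. x \<in> Ob C \<and> e \<in> Ar D \<and> src D e = fob F x \<and> tgt D e = y \<and> is_iso D e"
    using es by (fastforce simp: ess_surj_def hom_def)
  then obtain gob e where ge: "\<And>y. y \<in> Ob D \<Longrightarrow> gob y \<in> Ob C \<and> e y \<in> Ar D \<and>
      src D (e y) = fob F (gob y) \<and> tgt D (e y) = y \<and> is_iso D (e y)"
    by metis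
  have gob: "gob y \<in> Ob C" and e_Ar: "e y \<in> Ar D" and e_src: "src D (e y) = fob F (gob y)"
    and e_tgt: "tgt D (e y) = y" and e_iso: "is_iso D (e y)" if "y \<in> Ob D" for y
    using ge[OF that] by auto
  \<comment> \<open>One lifting property serves twice: applied to
    \<open>cmp D g (e (src D g))\<close> it yields the inverse functor on arrows, applied to an
    identity it yields the unit.\<close>
  have lift: "\<exists>f. f \<in> Ar C \<and> src C f = x \<and> tgt C f = gob (tgt D g) \<and> cmp D (e (tgt D g)) (far F f) = g"
    if g: "g \<in> Ar D" "x \<in> Ob C" "src D g = fob F x" for g x
  proof -
    let ?e = "e (tgt D g)"
    obtain i where i: "i \<in> Ar D" "src D i = tgt D g" "tgt D i = fob F (gob (tgt D g))"
      "cmp D ?e i = ide D (tgt D g)"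
      by (rule cod.is_isoE[OF e_iso[of "tgt D g"]]) (use g in \<open>auto simp: e_src e_tgt\<close>)
    obtain f where f: "f \<in> Ar C" "src C f = x" "tgt C f = gob (tgt D g)" "far F f = cmp D i g"
      by (rule fullE[OF ff(2), of x "gob (tgt D g)" "cmp D i g"]) (use g i in \<open>auto simp: gob\<close>)
    have "cmp D ?e (far F f) = cmp D (cmp D ?e i) g"
      using f(4) i(1-3) that by (simp add: cod.assoc e_Ar e_src)
    then have "cmp D ?e (far F f) = g"
      using i that by simp
    with f show ?thesis by blast
  qed
  have "\<forall>g \<in> Ar D. \<exists>f. f \<in> Ar C \<and> src C f = gob (src D g) \<and> tgt C f = gob (tgt D g) \<and>
      cmp D (e (tgt D g)) (far F f) = cmp D g (e (src D g))"
  proof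
    fix g assume "g \<in> Ar D"
    then show "\<exists>f. f \<in> Ar C \<and> src C f = gob (src D g) \<and> tgt C f = gob (tgt D g) \<and>
      cmp D (e (tgt D g)) (far F f) = cmp D g (e (src D g))"
      using lift[of "cmp D g (e (src D g))" "gob (src D g)"] by (simp add: e_Ar e_src e_tgt gob)
  qed
  then obtain gar where gar': "\<And>g. g \<in> Ar D \<Longrightarrow> gar g \<in> Ar C \<and> src C (gar g) = gob (src D g) \<and>
      tgt C (gar g) = gob (tgt D g) \<and> cmp D (e (tgt D g)) (far F (gar g)) = cmp D g (e (src D g))"
    by metis
  have gar [simp]: "gar g \<in> Ar C" "src C (gar g) = gob (src D g)" "tgt C (gar g) = gob (tgt D g)"
    and gar_eq: "cmp D (e (tgt D g)) (far F (gar g)) = cmp D g (e (src D g))" if "g \<in> Ar D" for g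
    using gar'[OF that] by auto
  \<comment> \<open>By faithfulness the defining square determines the chosen arrow, so each functor
    law reduces to checking that square.\<close>
  have gar_unique: "gar g = f"
    if "g \<in> Ar D" "f \<in> Ar C" "src C f = gob (src D g)" "tgt C f = gob (tgt D g)"
      "cmp D (e (tgt D g)) (far F f) = cmp D g (e (src D g))" for g f
  proof (rule faithfulD[OF ff(1)])
    show "far F (gar g) = far F f"
      by (rule cod.iso_cancel_left[OF e_iso[of "tgt D g"]]) (use that in \<open>auto simp: e_src gar_eq\<close>)
  qed (use that in auto)
  define G where "G = \<lparr>fob = gob, far = gar\<rparr>"
  have G: "is_functor D C G"
    unfolding is_functor_def
  proof (intro conjI ballI impI dom.is_category cod.is_category)
    fix f g
    assume fg: "f \<in> Ar D" "g \<in> Ar D" "src D g = tgt D f"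
    have "cmp D (e (tgt D g)) (cmp D (far F (gar g)) (far F (gar f))) =
        cmp D (cmp D (e (tgt D g)) (far F (gar g))) (far F (gar f))"
      using fg by (simp add: cod.assoc e_Ar e_src)
    also have "\<dots> = cmp D g (cmp D (e (src D g)) (far F (gar f)))"
      using fg by (simp add: gar_eq cod.assoc e_Ar e_src e_tgt)
    also have "\<dots> = cmp D (cmp D g f) (e (src D f))"
      using fg by (simp add: gar_eq cod.assoc e_Ar e_src e_tgt)
    finally show "far G (cmp D g f) = cmp C (far G g) (far G f)"
      using fg by (auto simp: G_def intro!: gar_unique)
  qed (auto simp: G_def hom_def gob e_Ar e_src e_tgt intro!: gar_unique)
  have "\<forall>x \<in> Ob C. \<exists>f. f \<in> Ar C \<and> src C f = x \<and> tgt C f = gob (fob F x) \<and>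
      cmp D (e (fob F x)) (far F f) = ide D (fob F x)"
  proof
    fix x assume "x \<in> Ob C"
    then show "\<exists>f. f \<in> Ar C \<and> src C f = x \<and> tgt C f = gob (fob F x) \<and>
      cmp D (e (fob F x)) (far F f) = ide D (fob F x)"
      using lift[of "ide D (fob F x)" x] by simp
  qed
  then obtain \<eta> where \<eta>': "\<And>x. x \<in> Ob C \<Longrightarrow> \<eta> x \<in> Ar C \<and> src C (\<eta> x) = x \<and>
      tgt C (\<eta> x) = gob (fob F x) \<and> cmp D (e (fob F x)) (far F (\<eta> x)) = ide D (fob F x)"
    by metis
  have \<eta> [simp]: "\<eta> x \<in> Ar C" "src C (\<eta> x) = x" "tgt C (\<eta> x) = gob (fob F x)"
    and \<eta>_eq: "cmp D (e (fob F x)) (far F (\<eta> x)) = ide D (fob F x)" if "x \<in> Ob C" for x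
    using \<eta>'[OF that] by auto
  \<comment> \<open>The image of \<open>\<eta> x\<close> is inverse to \<open>e (fob F x)\<close>:
    on one side by construction, on the other by cancelling the isomorphism
    \<open>e (fob F x)\<close>.\<close>
  have \<eta>_iso: "is_iso C (\<eta> x)" if x: "x \<in> Ob C" for x
  proof (rule fully_faithful_reflects_iso[OF ff])
    let ?e = "e (fob F x)"
    have "cmp D ?e (cmp D (far F (\<eta> x)) ?e) = cmp D (cmp D ?e (far F (\<eta> x))) ?e"
      using x by (simp add: cod.assoc e_Ar e_src e_tgt)
    also have "\<dots> = cmp D ?e (ide D (fob F (gob (fob F x))))"
      using x by (simp add: \<eta>_eq e_Ar e_src e_tgt)
    finally have "cmp D (far F (\<eta> x)) ?e = ide D (fob F (gob (fob F x)))"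
      using x by - (rule cod.iso_cancel_left[OF e_iso[of "fob F x"]]; auto simp: e_Ar e_src e_tgt gob)
    then show "is_iso D (far F (\<eta> x))"
      using x by - (rule cod.is_isoI[of _ ?e]; auto simp: e_Ar e_src e_tgt \<eta>_eq)
  qed (use x in simp)
  have \<eta>_nat: "cmp C (gar (far F f)) (\<eta> (src C f)) = cmp C (\<eta> (tgt C f)) f" if f: "f \<in> Ar C" for f
  proof (rule faithfulD[OF ff(1)])
    let ?e = "e (fob F (tgt C f))"
    have "cmp D ?e (cmp D (far F (gar (far F f))) (far F (\<eta> (src C f)))) =
        cmp D (cmp D ?e (far F (gar (far F f)))) (far F (\<eta> (src C f)))"
      using f by (simp add: cod.assoc e_Ar e_src e_tgt)
    also have "\<dots> = cmp D (far F f) (cmp D (e (fob F (src C f))) (far F (\<eta> (src C f))))"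
      using gar_eq[of "far F f"] f by (simp add: cod.assoc e_Ar e_src e_tgt)
    also have "\<dots> = cmp D (cmp D ?e (far F (\<eta> (tgt C f)))) (far F f)"
      using f by (simp add: \<eta>_eq)
    also have "\<dots> = cmp D ?e (cmp D (far F (\<eta> (tgt C f))) (far F f))"
      using f by (simp add: cod.assoc e_Ar e_src e_tgt)
    finally have "cmp D (far F (gar (far F f))) (far F (\<eta> (src C f))) =
        cmp D (far F (\<eta> (tgt C f))) (far F f)"
      using f by - (rule cod.iso_cancel_left[OF e_iso[of "fob F (tgt C f)"]]; auto simp: e_src)
    then show "far F (cmp C (gar (far F f)) (\<eta> (src C f))) = far F (cmp C (\<eta> (tgt C f)) f)"
      using f by simp
  qed (use f in simp_all)
  have FG: "is_functor C C (comp_func G F)" "is_functor D D (comp_func F G)"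
    using is_functor G by (auto simp: is_functor_def comp_func_def hom_def)
  have "is_nat_iso C C id_func (comp_func G F) \<eta>"
    unfolding is_nat_iso_def using FG \<eta>_iso \<eta>_nat dom.is_category
    by (auto simp: G_def comp_func_def id_func_def hom_def is_functor_def)
  moreover have "is_nat_iso D D (comp_func F G) id_func e"
    unfolding is_nat_iso_def using FG cod.is_category e_iso
    by (auto simp: G_def comp_func_def id_func_def hom_def is_functor_def e_Ar e_src e_tgt gar_eq)
  ultimately show ?thesis
    using G is_functor by (auto simp: is_equivalence_def)
qed

end

section \<open>Smooth maps and the nerve of a Lie groupoid\<close>

text \<open>A partial derivative at a point of \<open>U\<close> looks along a whole coordinate line,
  which leaves \<open>U\<close> in general. Openness keeps the nearby part of the line inside
  \<open>U\<close>; \<open>i < n\<close> keeps it inside the Euclidean space.\<close>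

lemma eventually_fun_upd_in_open:
  assumes U: "openin (Euclidean_space n) U" and x: "x \<in> U" and i: "i < n"
  shows "\<forall>\<^sub>F h in nhds (x i). x(i := h) \<in> U"
proof -
  have xE: "x \<in> topspace (Euclidean_space n)"
    using openin_subset[OF U] x by blast
  have "continuous_map euclideanreal (powertop_real UNIV) (\<lambda>h. x(i := h))"
    unfolding continuous_map_componentwise_UNIV by (auto simp: fun_upd_def)
  then have "continuous_map euclideanreal (Euclidean_space n) (\<lambda>h. x(i := h))"
    using xE i by (auto simp: Euclidean_space_def continuous_map_in_subtopology)
  from openin_continuous_map_preimage[OF this U]
  have "open {h. x(i := h) \<in> U}" by simp
  moreover have "x i \<in> {h. x(i := h) \<in> U}" using x by simp
  ultimately show ?thesis
    unfolding eventually_nhds by blast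
qed

text \<open>Functions that agree on the open set \<open>U\<close> agree near each of its points
  along coordinate lines, hence have the same partial derivatives on \<open>U\<close>. Those agree
  only on \<open>U\<close> as well, which is why the induction varies both functions.\<close>

lemma Ck_on_cong:
  assumes U: "openin (Euclidean_space n) U"
  shows "(\<And>x. x \<in> U \<Longrightarrow> f x = g x) \<Longrightarrow> Ck_on n k U f \<Longrightarrow> Ck_on n k U g"
proof (induction k arbitrary: f g)
  case 0
  have "continuous_map (subtopology (Euclidean_space n) U) euclideanreal g"
    by (rule continuous_map_eq[where f = f]) (use 0 in auto)
  then show ?case by simp
next
  case (Suc k)
  have cont: "continuous_map (subtopology (Euclidean_space n) U) euclideanreal g"
    by (rule continuous_map_eq[where f = f]) (use Suc.prems in auto)
  have ev: "\<forall>\<^sub>F h in nhds (x i). f (x(i := h)) = g (x(i := h))" if "x \<in> U" "i < n" for x i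
    using eventually_fun_upd_in_open[OF U that] by eventually_elim (rule Suc.prems(1))
  have "(\<lambda>h. g (x(i := h))) differentiable (at (x i))" if x: "x \<in> U" and i: "i < n" for x i
  proof -
    have "(\<lambda>h. f (x(i := h))) differentiable (at (x i))"
      using Suc.prems(2) x i by simp
    then show ?thesis
      using DERIV_cong_ev[OF refl ev[OF x i] refl] by (auto simp: real_differentiable_def)
  qed
  moreover have "Ck_on n k U (partial i g)" if i: "i < n" for i
  proof (rule Suc.IH)
    show "Ck_on n k U (partial i f)"
      using Suc.prems(2) i by simp
    show "partial i f x = partial i g x" if "x \<in> U" for x
      unfolding partial_def by (rule deriv_cong_ev[OF ev[OF that i] refl])
  qed
  ultimately show ?case using cont by simp
qed

lemma smooth_on_cong:
  assumes "smooth_on n m U f" and "\<And>x. x \<in> U \<Longrightarrow> f x = g x"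
  shows "smooth_on n m U g"
proof -
  have "f ` U = g ` U" using assms(2) by (rule image_cong[OF refl])
  with assms show ?thesis
    by (auto simp: smooth_on_def intro: Ck_on_cong[where f = "\<lambda>x. f x _"])
qed

text \<open>Arrows of \<open>Man\<close> are extensional, so the structure maps of a groupoid enter
  only after restriction to the carrier. Chart domains lie in the carrier, hence the local
  representatives are unchanged where smoothness is tested.\<close>

lemma smooth_map_restrict:
  assumes M: "manifold M" and f: "smooth_map M N f"
  shows "smooth_map M N (restrict f (carrier M))"
  unfolding smooth_map_def
proof (intro conjI ballI)
  show "restrict f (carrier M) ` carrier M \<subseteq> carrier N"
    using f by (auto simp: smooth_map_def)
  fix x assume "x \<in> carrier M"
  with f have "\<exists>c \<in> atlas M. \<exists>c' \<in> atlas N. x \<in> fst c \<and> f ` fst c \<subseteq> fst c' \<and>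
      smooth_on (mdim M) (mdim N) (snd c ` fst c) (snd c' \<circ> f \<circ> inv_into (fst c) (snd c))"
    by (simp add: smooth_map_def case_prod_unfold)
  then obtain c c' where c: "c \<in> atlas M" and c': "c' \<in> atlas N" "x \<in> fst c" "f ` fst c \<subseteq> fst c'"
    and sm: "smooth_on (mdim M) (mdim N) (snd c ` fst c) (snd c' \<circ> f \<circ> inv_into (fst c) (snd c))"
    by blast
  have "is_chart (mtop M) (mdim M) c"
    using M c by (simp add: manifold_def)
  then have UM: "fst c \<subseteq> carrier M"
    by (auto simp: is_chart_def case_prod_unfold dest: openin_subset)
  have "smooth_on (mdim M) (mdim N) (snd c ` fst c)
      (snd c' \<circ> restrict f (carrier M) \<circ> inv_into (fst c) (snd c))"
  proof (rule smooth_on_cong[OF sm])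
    fix y assume "y \<in> snd c ` fst c"
    then have "inv_into (fst c) (snd c) y \<in> carrier M"
      using UM inv_into_into[of y "snd c" "fst c"] by blast
    then show "(snd c' \<circ> f \<circ> inv_into (fst c) (snd c)) y =
        (snd c' \<circ> restrict f (carrier M) \<circ> inv_into (fst c) (snd c)) y"
      by simp
  qed
  moreover have "restrict f (carrier M) ` fst c \<subseteq> fst c'" using c'(3) UM by auto
  ultimately have "\<exists>c \<in> atlas M. \<exists>c' \<in> atlas N. x \<in> fst c \<and> restrict f (carrier M) ` fst c \<subseteq> fst c' \<and>
      smooth_on (mdim M) (mdim N) (snd c ` fst c)
        (snd c' \<circ> restrict f (carrier M) \<circ> inv_into (fst c) (snd c))"
    using c c'(1,2) by (intro bexI[of _ c] bexI[of _ c'] conjI)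
  then show "\<exists>(U, \<phi>) \<in> atlas M. \<exists>(V, \<psi>) \<in> atlas N. x \<in> U \<and> restrict f (carrier M) ` U \<subseteq> V \<and>
      smooth_on (mdim M) (mdim N) (\<phi> ` U) (\<psi> \<circ> restrict f (carrier M) \<circ> inv_into U \<phi>)"
    by (simp add: case_prod_unfold)
qed

lemma man_arr_Ar:
  assumes "manifold M" "manifold N" "smooth_map M N f"
  shows "man_arr M N f \<in> Ar Man"
  using assms by (simp add: man_arr_def Man_def smooth_map_restrict)

lemma src_man_arr [simp]: "src Man (man_arr M N f) = M"
  and tgt_man_arr [simp]: "tgt Man (man_arr M N f) = N"
  by (simp_all add: man_arr_def Man_def)

lemma cmp_man_arr:
  assumes "f ` carrier M \<subseteq> carrier N"
  shows "cmp Man (man_arr N P g) (man_arr M N f) = man_arr M P (\<lambda>x. g (f x))"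
  using assms by (auto simp: man_arr_def Man_def compose_def restrict_def fun_eq_iff)

lemma man_arr_cong:
  "(\<And>x. x \<in> carrier M \<Longrightarrow> f x = g x) \<Longrightarrow> man_arr M N f = man_arr M N g"
  by (auto simp: man_arr_def restrict_def)

lemma lie_groupoid_arrows:
  assumes "lie_groupoid \<Gamma>"
  shows "s_arr \<Gamma> \<in> Ar Man" "t_arr \<Gamma> \<in> Ar Man" "d0 \<Gamma> \<in> Ar Man" "d1 \<Gamma> \<in> Ar Man" "d2 \<Gamma> \<in> Ar Man"
  using assms
  by (auto simp: s_arr_def t_arr_def d0_def d1_def d2_def lie_groupoid_def submersion_def
      is_fibre_product_def intro!: man_arr_Ar)

text \<open>On a composable pair the outer identities are the source and target laws for a product;
  the middle one is composability itself.\<close>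

lemma lie_groupoid_simplicial:
  assumes "lie_groupoid \<Gamma>"
  shows "cmp Man (s_arr \<Gamma>) (d1 \<Gamma>) = cmp Man (s_arr \<Gamma>) (d0 \<Gamma>)"
    and "cmp Man (s_arr \<Gamma>) (d2 \<Gamma>) = cmp Man (t_arr \<Gamma>) (d0 \<Gamma>)"
    and "cmp Man (t_arr \<Gamma>) (d1 \<Gamma>) = cmp Man (t_arr \<Gamma>) (d2 \<Gamma>)"
proof -
  have G2: "\<exists>x y. z = Couple x y \<and> x \<in> carrier (G1 \<Gamma>) \<and> y \<in> carrier (G1 \<Gamma>) \<and> gsrc \<Gamma> x = gtgt \<Gamma> y"
    if "z \<in> carrier (G2 \<Gamma>)" for z
    using assms that by (auto simp: lie_groupoid_def is_fibre_product_def)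
  have mul: "(\<lambda>z. gmul \<Gamma> (fst_pt z) (snd_pt z)) ` carrier (G2 \<Gamma>) \<subseteq> carrier (G1 \<Gamma>)"
    using assms by (simp add: lie_groupoid_def smooth_map_def)
  have st: "gsrc \<Gamma> (gmul \<Gamma> x y) = gsrc \<Gamma> y" "gtgt \<Gamma> (gmul \<Gamma> x y) = gtgt \<Gamma> x"
    if "x \<in> carrier (G1 \<Gamma>)" "y \<in> carrier (G1 \<Gamma>)" "gsrc \<Gamma> x = gtgt \<Gamma> y" for x y
    using assms that by (auto simp: lie_groupoid_def)
  have pr: "fst_pt ` carrier (G2 \<Gamma>) \<subseteq> carrier (G1 \<Gamma>)" "snd_pt ` carrier (G2 \<Gamma>) \<subseteq> carrier (G1 \<Gamma>)"
    using G2 by fastforce+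
  show "cmp Man (s_arr \<Gamma>) (d1 \<Gamma>) = cmp Man (s_arr \<Gamma>) (d0 \<Gamma>)"
    and "cmp Man (s_arr \<Gamma>) (d2 \<Gamma>) = cmp Man (t_arr \<Gamma>) (d0 \<Gamma>)"
    and "cmp Man (t_arr \<Gamma>) (d1 \<Gamma>) = cmp Man (t_arr \<Gamma>) (d2 \<Gamma>)"
    unfolding s_arr_def t_arr_def d0_def d1_def d2_def cmp_man_arr[OF mul] pr[THEN cmp_man_arr]
    using G2 by (fastforce intro!: man_arr_cong simp: st)+
qed

section \<open>Categories fibered in groupoids\<close>

locale fibration =
  fixes B :: "('m, 'n) cat" and X :: "('o, 'a) cat" and \<pi> :: "('o, 'a, 'm, 'n) func"
  assumes fibered: "fibered_in_groupoids B X \<pi>"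
begin

sublocale cat_functor X B \<pi>
  using fibered by unfold_locales (simp add: fibered_in_groupoids_def)

lemma lift:
  assumes "x \<in> Ob X" "f \<in> Ar B" "tgt B f = fob \<pi> x"
  obtains a where "a \<in> Ar X" "tgt X a = x" "far \<pi> a = f"
  using fibered assms by (fastforce simp: fibered_in_groupoids_def)

lemma cartesian_ex1:
  assumes "a \<in> Ar X" "b \<in> Ar X" "tgt X a = tgt X b" "k \<in> Ar B"
    "src B k = fob \<pi> (src X a)" "tgt B k = fob \<pi> (src X b)" "cmp B (far \<pi> b) k = far \<pi> a"
  shows "\<exists>!c. c \<in> hom X (src X a) (src X b) \<and> far \<pi> c = k \<and> cmp X b c = a"
proof -
  have "k \<in> hom B (fob \<pi> (src X a)) (fob \<pi> (src X b))"
    using assms by (simp add: hom_def)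
  then show ?thesis
    using fibered assms(1-3,7) unfolding fibered_in_groupoids_def by blast
qed

lemma cartesian:
  assumes "a \<in> Ar X" "b \<in> Ar X" "tgt X a = tgt X b" "k \<in> Ar B"
    "src B k = fob \<pi> (src X a)" "tgt B k = fob \<pi> (src X b)" "cmp B (far \<pi> b) k = far \<pi> a"
  obtains c where "c \<in> Ar X" "src X c = src X a" "tgt X c = src X b" "far \<pi> c = k" "cmp X b c = a"
  using cartesian_ex1[OF assms] by (auto simp: hom_def)

text \<open>The uniqueness half of cartesianness, used throughout as a substitute for
  \<open>b\<close> being monic: it separates arrows with equal base image.\<close>

lemma cartesian_cancel:
  assumes "b \<in> Ar X" "c \<in> Ar X" "c' \<in> Ar X" "tgt X c = src X b" "tgt X c' = src X b"
    "far \<pi> c = far \<pi> c'" "cmp X b c = cmp X b c'"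
  shows "c = c'"
proof -
  have "src X c = src X c'"
    using assms dom.src_cmp by metis
  then show ?thesis
    using cartesian_ex1[of "cmp X b c" b "far \<pi> c"] assms by (auto simp: hom_def)
qed

text \<open>The fibre is read off from the source, so that no base object has to be carried along;
  \<open>hom_fibre_iff\<close> translates back.\<close>

definition vertical :: "'a \<Rightarrow> bool" where
  "vertical u \<longleftrightarrow> u \<in> Ar X \<and> far \<pi> u = ide B (fob \<pi> (src X u))"

lemma vertical_Ar [simp]: "vertical u \<Longrightarrow> u \<in> Ar X"
  and far_vertical: "vertical u \<Longrightarrow> far \<pi> u = ide B (fob \<pi> (src X u))"
  by (auto simp: vertical_def)

lemma fob_tgt_vertical: "vertical u \<Longrightarrow> fob \<pi> (tgt X u) = fob \<pi> (src X u)"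
  using tgt_far[of u] by (simp add: vertical_def)

lemma vertical_ide [simp]: "x \<in> Ob X \<Longrightarrow> vertical (ide X x)"
  by (simp add: vertical_def)

lemma vertical_cmp [simp]:
  "vertical u \<Longrightarrow> vertical v \<Longrightarrow> src X v = tgt X u \<Longrightarrow> vertical (cmp X v u)"
  using fob_tgt_vertical[of u] by (simp add: vertical_def)

lemma far_cmp_vertical [simp]:
  "vertical u \<Longrightarrow> a \<in> Ar X \<Longrightarrow> src X a = tgt X u \<Longrightarrow> far \<pi> (cmp X a u) = far \<pi> a"
  "vertical u \<Longrightarrow> a \<in> Ar X \<Longrightarrow> src X u = tgt X a \<Longrightarrow> far \<pi> (cmp X u a) = far \<pi> a"
  by (auto simp: far_vertical fob_tgt_vertical[symmetric])

lemma hom_fibre_iff: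
  "u \<in> hom (fibre B X \<pi> M) x y \<longleftrightarrow> vertical u \<and> src X u = x \<and> tgt X u = y \<and> fob \<pi> x = M"
  using fob_tgt_vertical[of u] by (auto simp: hom_def fibre_def vertical_def)

text \<open>Fibres are groupoids. Factoring the identity through the cartesian arrow
  \<open>u\<close> gives a right inverse, and cancelling \<open>u\<close> shows that it is also a
  left inverse.\<close>

lemma vertical_inverse:
  assumes u: "vertical u"
  obtains v where "vertical v" "src X v = tgt X u" "tgt X v = src X u"
    "cmp X u v = ide X (tgt X u)" "cmp X v u = ide X (src X u)"
proof -
  note [simp] = far_vertical[OF u] fob_tgt_vertical[OF u]
  obtain v where v: "v \<in> Ar X" "src X v = tgt X u" "tgt X v = src X u"
      "far \<pi> v = ide B (fob \<pi> (src X u))" "cmp X u v = ide X (tgt X u)"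
    by (rule cartesian[of "ide X (tgt X u)" u "ide B (fob \<pi> (src X u))"]) (use u in auto)
  have vv: "vertical v" using v by (simp add: vertical_def)
  have "cmp X u (cmp X v u) = cmp X (cmp X u v) u"
    using u v(1-4) by (simp add: dom.assoc)
  then have "cmp X v u = ide X (src X u)"
    using u v vv by - (rule cartesian_cancel[of u]; auto)
  with v vv that show thesis by blast
qed

text \<open>Cartesianness of \<open>b\<close> gives exactly one factorisation of \<open>a\<close>
  through \<open>b\<close> over the identity, so the description defining \<open>canon\<close>
  denotes it.\<close>

lemma canon:
  assumes a: "a \<in> Ar X" and b: "b \<in> Ar X" and tgt: "tgt X a = tgt X b" and far: "far \<pi> a = far \<pi> b"
  shows "vertical (canon B X \<pi> a b)" "src X (canon B X \<pi> a b) = src X a"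
    "tgt X (canon B X \<pi> a b) = src X b" "cmp X b (canon B X \<pi> a b) = a"
proof -
  have base: "fob \<pi> (src X a) = fob \<pi> (src X b)"
    using src_far[OF a] src_far[OF b] far by simp
  obtain c where c: "c \<in> Ar X" "src X c = src X a" "tgt X c = src X b"
      "far \<pi> c = ide B (fob \<pi> (src X a))" "cmp X b c = a"
    by (rule cartesian[OF a b tgt, of "ide B (fob \<pi> (src X a))"]) (use a b far base in auto)
  have "\<exists>!u. u \<in> hom (fibre B X \<pi> (fob \<pi> (src X a))) (src X a) (src X b) \<and> cmp X b u = a"
  proof (rule ex1I[of _ c])
    fix u assume "u \<in> hom (fibre B X \<pi> (fob \<pi> (src X a))) (src X a) (src X b) \<and> cmp X b u = a"
    then show "u = c"
      using c b by - (rule cartesian_cancel[OF b]; auto simp: hom_fibre_iff far_vertical)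
  qed (use c in \<open>simp add: hom_fibre_iff vertical_def\<close>)
  from theI'[OF this]
  show "vertical (canon B X \<pi> a b)" "src X (canon B X \<pi> a b) = src X a"
    "tgt X (canon B X \<pi> a b) = src X b" "cmp X b (canon B X \<pi> a b) = a"
    by (auto simp: hom_fibre_iff canon_def)
qed

end

section \<open>Chosen pullbacks of objects and of vertical arrows\<close>

locale cleaved_fibration = fibration B X \<pi>
  for B :: "('m, 'n) cat" and X :: "('o, 'a) cat" and \<pi> :: "('o, 'a, 'm, 'n) func" +
  fixes \<kappa> :: "'o \<Rightarrow> 'n \<Rightarrow> 'a"
  assumes cleavage: "is_cleavage B X \<pi> \<kappa>"
begin

lemma cleavage_Ar [simp]: "x \<in> Ob X \<Longrightarrow> f \<in> Ar B \<Longrightarrow> tgt B f = fob \<pi> x \<Longrightarrow> \<kappa> x f \<in> Ar X"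
  and tgt_cleavage [simp]: "x \<in> Ob X \<Longrightarrow> f \<in> Ar B \<Longrightarrow> tgt B f = fob \<pi> x \<Longrightarrow> tgt X (\<kappa> x f) = x"
  and far_cleavage [simp]: "x \<in> Ob X \<Longrightarrow> f \<in> Ar B \<Longrightarrow> tgt B f = fob \<pi> x \<Longrightarrow> far \<pi> (\<kappa> x f) = f"
  using cleavage by (auto simp: is_cleavage_def)

lemma fob_src_cleavage [simp]:
  "x \<in> Ob X \<Longrightarrow> f \<in> Ar B \<Longrightarrow> tgt B f = fob \<pi> x \<Longrightarrow> fob \<pi> (src X (\<kappa> x f)) = src B f"
  using src_far[of "\<kappa> x f"] by simp

lemma pull_arr:
  assumes u: "vertical u" and f: "f \<in> Ar B" "tgt B f = fob \<pi> (src X u)"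
  shows "vertical (pull_arr B X \<pi> \<kappa> f u)"
    "src X (pull_arr B X \<pi> \<kappa> f u) = src X (\<kappa> (src X u) f)"
    "tgt X (pull_arr B X \<pi> \<kappa> f u) = src X (\<kappa> (tgt X u) f)"
    "cmp X (\<kappa> (tgt X u) f) (pull_arr B X \<pi> \<kappa> f u) = cmp X u (\<kappa> (src X u) f)"
proof -
  \<comment> \<open>A pulled-back arrow is itself a canonical comparison, between two arrows over
    \<open>f\<close> with target \<open>tgt X u\<close>.\<close>
  have "pull_arr B X \<pi> \<kappa> f u = canon B X \<pi> (cmp X u (\<kappa> (src X u) f)) (\<kappa> (tgt X u) f)"
    using u f by (simp add: pull_arr_def canon_def pull_def)
  then show "vertical (pull_arr B X \<pi> \<kappa> f u)"
    "src X (pull_arr B X \<pi> \<kappa> f u) = src X (\<kappa> (src X u) f)"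
    "tgt X (pull_arr B X \<pi> \<kappa> f u) = src X (\<kappa> (tgt X u) f)"
    "cmp X (\<kappa> (tgt X u) f) (pull_arr B X \<pi> \<kappa> f u) = cmp X u (\<kappa> (src X u) f)"
    using canon[of "cmp X u (\<kappa> (src X u) f)" "\<kappa> (tgt X u) f"] u f
    by (auto simp: fob_tgt_vertical[OF u] far_vertical[OF u])
qed

end

section \<open>Cocycles as spans\<close>

text \<open>The parameters \<open>s, t, e0, e1, e2\<close> stand for the source and target maps of \<open>\<Gamma>\<close> and for
  \<open>d\<^sub>0, d\<^sub>1, d\<^sub>2\<close>. A triple \<open>x0, x1, x2\<close> lies over the arrows \<open>\<gamma>\<^sub>2, \<gamma>\<^sub>1\<gamma>\<^sub>2, \<gamma>\<^sub>1\<close> of a composable pair.\<close>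

locale span_fibration = fibration B X \<pi>
  for B :: "('m, 'n) cat" and X :: "('o, 'a) cat" and \<pi> :: "('o, 'a, 'm, 'n) func" +
  fixes s t e0 e1 e2 :: 'n
  assumes s [simp]: "s \<in> Ar B" and t [simp]: "t \<in> Ar B"
    and e [simp]: "e0 \<in> Ar B" "e1 \<in> Ar B" "e2 \<in> Ar B"
    and src_t [simp]: "src B t = src B s" and tgt_t [simp]: "tgt B t = tgt B s"
    and tgt_e [simp]: "tgt B e0 = src B s" "tgt B e1 = src B s" "tgt B e2 = src B s"
    and src_e [simp]: "src B e1 = src B e0" "src B e2 = src B e0"
    and s_e1: "cmp B s e1 = cmp B s e0" and s_e2: "cmp B s e2 = cmp B t e0"
    and t_e1: "cmp B t e1 = cmp B t e2"
begin

definition is_span :: "'a \<Rightarrow> 'a \<Rightarrow> bool" where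
  "is_span \<sigma> \<rho> \<longleftrightarrow> \<sigma> \<in> Ar X \<and> \<rho> \<in> Ar X \<and> src X \<rho> = src X \<sigma> \<and> tgt X \<rho> = tgt X \<sigma> \<and>
     far \<pi> \<sigma> = s \<and> far \<pi> \<rho> = t"

text \<open>Think of \<sigma> and \<rho> as start and end of a transport. Then \<open>x1\<close>
  starts where \<open>x0\<close> starts, and \<open>x2\<close> starts where \<open>x0\<close> ends;
  the cocycle condition will say that \<open>x2\<close> and \<open>x1\<close> end alike.\<close>

definition is_triple :: "'a \<Rightarrow> 'a \<Rightarrow> 'a \<Rightarrow> 'a \<Rightarrow> 'a \<Rightarrow> bool" where
  "is_triple \<sigma> \<rho> x0 x1 x2 \<longleftrightarrow> x0 \<in> Ar X \<and> x1 \<in> Ar X \<and> x2 \<in> Ar X \<and>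
     src X x1 = src X x0 \<and> src X x2 = src X x0 \<and>
     tgt X x0 = src X \<sigma> \<and> tgt X x1 = src X \<sigma> \<and> tgt X x2 = src X \<sigma> \<and>
     far \<pi> x0 = e0 \<and> far \<pi> x1 = e1 \<and> far \<pi> x2 = e2 \<and>
     cmp X \<sigma> x1 = cmp X \<sigma> x0 \<and> cmp X \<sigma> x2 = cmp X \<rho> x0"

text \<open>The quantifier over all triples makes the condition independent of choices. It is never
  vacuous by \<open>ex_triple\<close>, and one triple suffices to verify it by
  \<open>cocycle_spanI\<close>.\<close>

definition cocycle_span :: "'a \<Rightarrow> 'a \<Rightarrow> bool" where
  "cocycle_span \<sigma> \<rho> \<longleftrightarrow> is_span \<sigma> \<rho> \<and>
     (\<forall>x0 x1 x2. is_triple \<sigma> \<rho> x0 x1 x2 \<longrightarrow> cmp X \<rho> x2 = cmp X \<rho> x1)"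

lemma fob_src_span: "is_span \<sigma> \<rho> \<Longrightarrow> fob \<pi> (src X \<sigma>) = src B s"
  using src_far[of \<sigma>] by (auto simp: is_span_def)

text \<open>Any lift \<open>x0\<close> of \<open>e0\<close> to the apex extends: \<open>s_e1\<close>
  and \<open>s_e2\<close> are what allows the composites of \<open>x0\<close> with \<sigma> and
  \<rho> to be factored through \<sigma> over \<open>e1\<close> and \<open>e2\<close>.\<close>

lemma ex_triple:
  assumes sp: "is_span \<sigma> \<rho>"
  obtains x0 x1 x2 where "is_triple \<sigma> \<rho> x0 x1 x2"
proof -
  note sp' = sp[unfolded is_span_def] fob_src_span[OF sp]
  obtain x0 where x0: "x0 \<in> Ar X" "tgt X x0 = src X \<sigma>" "far \<pi> x0 = e0"
    using lift[of "src X \<sigma>" e0] sp' by auto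
  have b: "fob \<pi> (src X x0) = src B e0"
    using src_far[of x0] x0 by simp
  obtain x1 where "x1 \<in> Ar X" "src X x1 = src X x0" "tgt X x1 = src X \<sigma>" "far \<pi> x1 = e1"
      "cmp X \<sigma> x1 = cmp X \<sigma> x0"
    by (rule cartesian[of "cmp X \<sigma> x0" \<sigma> e1]) (use x0 sp' b in \<open>auto simp: s_e1\<close>)
  moreover obtain x2 where "x2 \<in> Ar X" "src X x2 = src X x0" "tgt X x2 = src X \<sigma>" "far \<pi> x2 = e2"
      "cmp X \<sigma> x2 = cmp X \<rho> x0"
    by (rule cartesian[of "cmp X \<rho> x0" \<sigma> e2]) (use x0 sp' b in \<open>auto simp: s_e2\<close>)
  ultimately show thesis
    using that x0 by (simp add: is_triple_def)
qed

text \<open>Any two triples on the same span differ by a vertical isomorphism of their sources.\<close>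

lemma cocycle_spanI:
  assumes sp: "is_span \<sigma> \<rho>" and x: "is_triple \<sigma> \<rho> x0 x1 x2" and eq: "cmp X \<rho> x2 = cmp X \<rho> x1"
  shows "cocycle_span \<sigma> \<rho>"
  unfolding cocycle_span_def
proof (intro conjI allI impI sp)
  fix y0 y1 y2
  assume y: "is_triple \<sigma> \<rho> y0 y1 y2"
  note defs = sp[unfolded is_span_def] x[unfolded is_triple_def] y[unfolded is_triple_def]
  define u where "u = canon B X \<pi> y0 x0"
  have u: "vertical u" "src X u = src X y0" "tgt X u = src X x0" "cmp X x0 u = y0"
    unfolding u_def by (rule canon; use defs in simp)+
  \<comment> \<open>Once \<open>y0\<close> is \<open>cmp X x0 u\<close>, the other two members are
    forced: the candidates lie over the same base arrows and agree after composition with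
    \<sigma>.\<close>
  have "cmp X \<sigma> (cmp X x1 u) = cmp X \<sigma> (cmp X x0 u)"
    using defs u(1-3) by (simp add: dom.assoc[symmetric])
  then have 1: "cmp X x1 u = y1"
    using defs u by - (rule cartesian_cancel[of \<sigma>]; auto simp del: far_cmp)
  have "cmp X \<sigma> (cmp X x2 u) = cmp X \<rho> (cmp X x0 u)"
    using defs u(1-3) by (simp add: dom.assoc[symmetric])
  then have 2: "cmp X x2 u = y2"
    using defs u by - (rule cartesian_cancel[of \<sigma>]; auto simp del: far_cmp)
  have "cmp X \<rho> (cmp X x2 u) = cmp X \<rho> (cmp X x1 u)"
    using defs u(1-3) eq by (simp add: dom.assoc[symmetric])
  then show "cmp X \<rho> y2 = cmp X \<rho> y1"
    using 1 2 by simp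
qed

text \<open>The arrow \<open>u\<close> between the apexes is determined by \<alpha>, because
  \<sigma>' can be cancelled among vertical arrows; hence it is only asserted to exist. For the
  spans of cocycles it is s^*\<alpha>.\<close>

definition span_hom :: "'a \<Rightarrow> 'a \<Rightarrow> 'a \<Rightarrow> 'a \<Rightarrow> 'a \<Rightarrow> bool" where
  "span_hom \<sigma> \<rho> \<sigma>' \<rho>' \<alpha> \<longleftrightarrow> is_span \<sigma> \<rho> \<and> is_span \<sigma>' \<rho>' \<and>
     vertical \<alpha> \<and> src X \<alpha> = tgt X \<sigma> \<and> tgt X \<alpha> = tgt X \<sigma>' \<and>
     (\<exists>u. vertical u \<and> src X u = src X \<sigma> \<and> tgt X u = src X \<sigma>' \<and>
        cmp X \<sigma>' u = cmp X \<alpha> \<sigma> \<and> cmp X \<rho>' u = cmp X \<alpha> \<rho>)"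

lemma span_hom_ide: "is_span \<sigma> \<rho> \<Longrightarrow> x = tgt X \<sigma> \<Longrightarrow> span_hom \<sigma> \<rho> \<sigma> \<rho> (ide X x)"
  by (auto simp: span_hom_def is_span_def intro!: exI[of _ "ide X (src X \<sigma>)"])

lemma span_hom_cmp:
  assumes \<alpha>: "span_hom \<sigma> \<rho> \<sigma>' \<rho>' \<alpha>" and \<beta>: "span_hom \<sigma>' \<rho>' \<sigma>'' \<rho>'' \<beta>"
  shows "span_hom \<sigma> \<rho> \<sigma>'' \<rho>'' (cmp X \<beta> \<alpha>)"
proof -
  obtain u v where u: "vertical u" "src X u = src X \<sigma>" "tgt X u = src X \<sigma>'"
        "cmp X \<sigma>' u = cmp X \<alpha> \<sigma>" "cmp X \<rho>' u = cmp X \<alpha> \<rho>"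
    and v: "vertical v" "src X v = src X \<sigma>'" "tgt X v = src X \<sigma>''"
        "cmp X \<sigma>'' v = cmp X \<beta> \<sigma>'" "cmp X \<rho>'' v = cmp X \<beta> \<rho>'"
    using \<alpha> \<beta> by (auto simp: span_hom_def)
  note defs = \<alpha>[unfolded span_hom_def is_span_def] \<beta>[unfolded span_hom_def is_span_def]
  have "cmp X \<sigma>'' (cmp X v u) = cmp X (cmp X \<sigma>'' v) u"
    using defs u(1-3) v(1-3) by (simp add: dom.assoc)
  also have "\<dots> = cmp X \<beta> (cmp X \<sigma>' u)"
    using defs u(1-3) v by (simp add: dom.assoc[of u "\<sigma>'"])
  also have "\<dots> = cmp X (cmp X \<beta> \<alpha>) \<sigma>"
    using defs u by (simp add: dom.assoc[of "\<sigma>" \<alpha>])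
  finally have 1: "cmp X \<sigma>'' (cmp X v u) = cmp X (cmp X \<beta> \<alpha>) \<sigma>" .
  have "cmp X \<rho>'' (cmp X v u) = cmp X (cmp X \<rho>'' v) u"
    using defs u(1-3) v(1-3) by (simp add: dom.assoc)
  also have "\<dots> = cmp X \<beta> (cmp X \<rho>' u)"
    using defs u(1-3) v by (simp add: dom.assoc[of u "\<rho>'"])
  also have "\<dots> = cmp X (cmp X \<beta> \<alpha>) \<rho>"
    using defs u by (simp add: dom.assoc[of "\<rho>" \<alpha>])
  finally have 2: "cmp X \<rho>'' (cmp X v u) = cmp X (cmp X \<beta> \<alpha>) \<rho>" .
  show ?thesis
    unfolding span_hom_def
    using \<alpha> \<beta> 1 2 u v by (auto simp: span_hom_def intro!: exI[of _ "cmp X v u"])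
qed

text \<open>The apex arrow \<open>u\<close> is vertical, hence has an inverse \<open>v\<close>. For
  either leg, insert \<open>cmp X \<beta> \<alpha>\<close>, pass \<alpha> across the square to
  \<open>u\<close>, and cancel \<open>u\<close> against \<open>v\<close>.\<close>

lemma span_hom_inverse:
  assumes \<alpha>: "span_hom \<sigma> \<rho> \<sigma>' \<rho>' \<alpha>"
    and \<beta>: "vertical \<beta>" "src X \<beta> = tgt X \<alpha>" "tgt X \<beta> = src X \<alpha>" "cmp X \<beta> \<alpha> = ide X (src X \<alpha>)"
  shows "span_hom \<sigma>' \<rho>' \<sigma> \<rho> \<beta>"
proof -
  obtain u where u: "vertical u" "src X u = src X \<sigma>" "tgt X u = src X \<sigma>'"
        "cmp X \<sigma>' u = cmp X \<alpha> \<sigma>" "cmp X \<rho>' u = cmp X \<alpha> \<rho>"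
    using \<alpha> by (auto simp: span_hom_def)
  note defs = \<alpha>[unfolded span_hom_def is_span_def]
  obtain v where v: "vertical v" "src X v = src X \<sigma>'" "tgt X v = src X \<sigma>"
      "cmp X u v = ide X (src X \<sigma>')"
    using vertical_inverse[OF u(1)] u by metis
  have *: "cmp X \<tau> v = cmp X \<beta> \<tau>'"
    if "\<tau> \<in> Ar X" "\<tau>' \<in> Ar X" "src X \<tau> = src X \<sigma>" "src X \<tau>' = src X \<sigma>'" "tgt X \<tau> = tgt X \<sigma>"
      "tgt X \<tau>' = tgt X \<sigma>'" "cmp X \<tau>' u = cmp X \<alpha> \<tau>" for \<tau> \<tau>'
  proof -
    have "cmp X \<tau> v = cmp X (cmp X (cmp X \<beta> \<alpha>) \<tau>) v"
      using \<beta> that defs v by simp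
    also have "\<dots> = cmp X (cmp X \<beta> (cmp X \<alpha> \<tau>)) v"
      using \<beta>(1-3) that defs by (simp add: dom.assoc)
    also have "\<dots> = cmp X (cmp X \<beta> (cmp X \<tau>' u)) v"
      using that by simp
    also have "\<dots> = cmp X \<beta> (cmp X \<tau>' (cmp X u v))"
      using \<beta>(1-3) that(1-6) defs u(1-3) v(1-3) by (simp add: dom.assoc)
    also have "\<dots> = cmp X \<beta> \<tau>'"
      using that v by simp
    finally show ?thesis .
  qed
  have "cmp X \<sigma> v = cmp X \<beta> \<sigma>'" "cmp X \<rho> v = cmp X \<beta> \<rho>'"
    by (rule *; use defs u in simp)+
  then show ?thesis
    unfolding span_hom_def using \<alpha> \<beta> v by (auto simp: span_hom_def)
qed

text \<open>A triple is pushed forward along the apex arrow \<open>u\<close>. Every composite with a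
  leg of the new span equals \<alpha> after the old composite, so all the equations carry
  over.\<close>

lemma cocycle_span_transfer:
  assumes \<alpha>: "span_hom \<sigma> \<rho> \<sigma>' \<rho>' \<alpha>" and co: "cocycle_span \<sigma> \<rho>"
  shows "cocycle_span \<sigma>' \<rho>'"
proof -
  obtain u where u: "vertical u" "src X u = src X \<sigma>" "tgt X u = src X \<sigma>'"
        "cmp X \<sigma>' u = cmp X \<alpha> \<sigma>" "cmp X \<rho>' u = cmp X \<alpha> \<rho>"
    using \<alpha> by (auto simp: span_hom_def)
  obtain x0 x1 x2 where x: "is_triple \<sigma> \<rho> x0 x1 x2"
    by (rule ex_triple) (use \<alpha> in \<open>auto simp: span_hom_def\<close>)
  have eq: "cmp X \<rho> x2 = cmp X \<rho> x1"
    using co x by (auto simp: cocycle_span_def)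
  note defs = \<alpha>[unfolded span_hom_def is_span_def] x[unfolded is_triple_def]
  have push: "cmp X \<tau>' (cmp X u y) = cmp X \<alpha> (cmp X \<tau> y)"
    if "\<tau> \<in> Ar X" "\<tau>' \<in> Ar X" "src X \<tau> = src X \<sigma>" "src X \<tau>' = src X \<sigma>'" "tgt X \<tau> = tgt X \<sigma>"
      "cmp X \<tau>' u = cmp X \<alpha> \<tau>" "y \<in> Ar X" "tgt X y = src X \<sigma>" for \<tau> \<tau>' y
  proof -
    have "cmp X \<tau>' (cmp X u y) = cmp X (cmp X \<tau>' u) y"
      using that(1-5,7,8) u(1-3) by (simp add: dom.assoc)
    also have "\<dots> = cmp X \<alpha> (cmp X \<tau> y)"
      using that defs by (simp add: dom.assoc[of y \<tau>])
    finally show ?thesis .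
  qed
  have \<sigma>: "cmp X \<sigma>' (cmp X u y) = cmp X \<alpha> (cmp X \<sigma> y)"
    and \<rho>: "cmp X \<rho>' (cmp X u y) = cmp X \<alpha> (cmp X \<rho> y)"
    if "y \<in> Ar X" "tgt X y = src X \<sigma>" for y
    by (rule push; use that defs u in simp)+
  show ?thesis
  proof (rule cocycle_spanI)
    show "is_span \<sigma>' \<rho>'" using \<alpha> by (simp add: span_hom_def)
    show "is_triple \<sigma>' \<rho>' (cmp X u x0) (cmp X u x1) (cmp X u x2)"
      using defs u fob_src_span[of \<sigma> \<rho>]
      by (simp add: is_triple_def \<sigma> \<rho> far_vertical is_span_def)
    show "cmp X \<rho>' (cmp X u x2) = cmp X \<rho>' (cmp X u x1)"
      using defs eq by (simp add: \<rho>)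
  qed
qed

end

section \<open>Cocycles of a Lie groupoid and their category\<close>

lemma source_target_arrows [simp]:
  "src Man (s_arr \<Gamma>) = G1 \<Gamma>" "tgt Man (s_arr \<Gamma>) = G0 \<Gamma>"
  "src Man (t_arr \<Gamma>) = G1 \<Gamma>" "tgt Man (t_arr \<Gamma>) = G0 \<Gamma>"
  "src Man (d0 \<Gamma>) = G2 \<Gamma>" "tgt Man (d0 \<Gamma>) = G1 \<Gamma>"
  "src Man (d1 \<Gamma>) = G2 \<Gamma>" "tgt Man (d1 \<Gamma>) = G1 \<Gamma>"
  "src Man (d2 \<Gamma>) = G2 \<Gamma>" "tgt Man (d2 \<Gamma>) = G1 \<Gamma>"
  by (simp_all add: s_arr_def t_arr_def d0_def d1_def d2_def)

lemma Ob_fibre: "Ob (fibre B X \<pi> M) = {x \<in> Ob X. fob \<pi> x = M}"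
  by (simp add: fibre_def)

locale cocycles = cleaved_fibration Man X \<pi> \<kappa>
  for X :: "('o, 'a) cat" and \<pi> :: "('o, 'a, 'm pt mfd, 'm man_arrow) func"
    and \<kappa> :: "'o \<Rightarrow> 'm man_arrow \<Rightarrow> 'a" +
  fixes \<Gamma> :: "'m groupoid"
  assumes lie: "lie_groupoid \<Gamma>"
begin

sublocale span_fibration Man X \<pi> "s_arr \<Gamma>" "t_arr \<Gamma>" "d0 \<Gamma>" "d1 \<Gamma>" "d2 \<Gamma>"
  by unfold_locales (simp_all add: lie_groupoid_arrows lie_groupoid_simplicial lie)

abbreviation sleg :: "'o \<Rightarrow> 'a" where
  "sleg p \<equiv> \<kappa> p (s_arr \<Gamma>)"

text \<open>For \<open>p\<close> over the objects of \<Gamma>, each arrow s^*p -> p over the target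
  map arises in this way from exactly one vertical \<phi>, by cartesianness of
  \<open>\<kappa> p (t_arr \<Gamma>)\<close>. So nothing is lost in passing from \<phi> to the
  span.\<close>

abbreviation tleg :: "'o \<Rightarrow> 'a \<Rightarrow> 'a" where
  "tleg p \<phi> \<equiv> cmp X (\<kappa> p (t_arr \<Gamma>)) \<phi>"

definition precocycle :: "'o \<Rightarrow> 'a \<Rightarrow> bool" where
  "precocycle p \<phi> \<longleftrightarrow> p \<in> Ob X \<and> fob \<pi> p = G0 \<Gamma> \<and> vertical \<phi> \<and>
     src X \<phi> = src X (\<kappa> p (s_arr \<Gamma>)) \<and> tgt X \<phi> = src X (\<kappa> p (t_arr \<Gamma>))"

lemma precocycle_span: "precocycle p \<phi> \<Longrightarrow> is_span (sleg p) (tleg p \<phi>)"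
  by (simp add: precocycle_def is_span_def del: far_cmp)

text \<open>Both sides of the cocycle condition are vertical arrows into d2^*t^*p. Composing them
  with the cartesian arrow from there to \<open>p\<close> loses no information and absorbs every
  canonical isomorphism; what remains is the span condition on one triple.\<close>

lemma is_cocycle_iff:
  "is_cocycle \<Gamma> X \<pi> \<kappa> (p, \<phi>) \<longleftrightarrow> precocycle p \<phi> \<and> cocycle_span (sleg p) (tleg p \<phi>)"
proof (cases "precocycle p \<phi>")
  case False
  then show ?thesis
    by (auto simp: is_cocycle_def Let_def hom_fibre_iff pull_def precocycle_def Ob_fibre)
next
  case True
  note pre = True[unfolded precocycle_def]
  let ?s = "s_arr \<Gamma>" and ?t = "t_arr \<Gamma>" and ?d0 = "d0 \<Gamma>" and ?d1 = "d1 \<Gamma>" and ?d2 = "d2 \<Gamma>"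
  let ?pb = "pull_arr Man X \<pi> \<kappa>" and ?c = "canon Man X \<pi>" and ?l = "lift2 X \<kappa> p"
  let ?w = "src X (\<kappa> p ?s)" and ?v = "src X (\<kappa> p ?t)"
  have obj: "?w \<in> Ob X" "?v \<in> Ob X" using pre by simp_all
  have far_obj: "fob \<pi> ?w = G1 \<Gamma>" "fob \<pi> ?v = G1 \<Gamma>" using pre by simp_all
  define w0 w1 w2 where "w0 = \<kappa> ?w ?d0" and "w1 = \<kappa> ?w ?d1" and "w2 = \<kappa> ?w ?d2"
  define v0 v1 v2 where "v0 = \<kappa> ?v ?d0" and "v1 = \<kappa> ?v ?d1" and "v2 = \<kappa> ?v ?d2"
  have w: "w0 \<in> Ar X" "w1 \<in> Ar X" "w2 \<in> Ar X" "tgt X w0 = ?w" "tgt X w1 = ?w" "tgt X w2 = ?w"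
      "far \<pi> w0 = ?d0" "far \<pi> w1 = ?d1" "far \<pi> w2 = ?d2"
    and v: "v0 \<in> Ar X" "v1 \<in> Ar X" "v2 \<in> Ar X" "tgt X v0 = ?v" "tgt X v1 = ?v" "tgt X v2 = ?v"
      "far \<pi> v0 = ?d0" "far \<pi> v1 = ?d1" "far \<pi> v2 = ?d2"
    using obj far_obj by (simp_all add: w0_def w1_def w2_def v0_def v1_def v2_def)
  have l_eq: "?l ?s ?d0 = cmp X (\<kappa> p ?s) w0" "?l ?s ?d1 = cmp X (\<kappa> p ?s) w1"
      "?l ?s ?d2 = cmp X (\<kappa> p ?s) w2" "?l ?t ?d0 = cmp X (\<kappa> p ?t) v0"
      "?l ?t ?d1 = cmp X (\<kappa> p ?t) v1" "?l ?t ?d2 = cmp X (\<kappa> p ?t) v2"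
    by (simp_all add: lift2_def pull_def w0_def w1_def w2_def v0_def v1_def v2_def)
  define b0 b1 b2 where "b0 = ?pb ?d0 \<phi>" and "b1 = ?pb ?d1 \<phi>" and "b2 = ?pb ?d2 \<phi>"
  have b: "vertical b0" "src X b0 = src X w0" "tgt X b0 = src X v0" "cmp X v0 b0 = cmp X \<phi> w0"
      "vertical b1" "src X b1 = src X w1" "tgt X b1 = src X v1" "cmp X v1 b1 = cmp X \<phi> w1"
      "vertical b2" "src X b2 = src X w2" "tgt X b2 = src X v2" "cmp X v2 b2 = cmp X \<phi> w2"
    using pull_arr[of \<phi> ?d0] pull_arr[of \<phi> ?d1] pull_arr[of \<phi> ?d2] pre far_obj
    by (simp_all add: b0_def b1_def b2_def w0_def w1_def w2_def v0_def v1_def v2_def)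
  define c02 c01 c12 where "c02 = ?c (cmp X (\<kappa> p ?t) v0) (cmp X (\<kappa> p ?s) w2)"
    and "c01 = ?c (cmp X (\<kappa> p ?s) w0) (cmp X (\<kappa> p ?s) w1)" and "c12 = ?c (cmp X (\<kappa> p ?t) v1) (cmp X (\<kappa> p ?t) v2)"
  have c02: "vertical c02" "src X c02 = src X v0" "tgt X c02 = src X w2"
      "cmp X (cmp X (\<kappa> p ?s) w2) c02 = cmp X (\<kappa> p ?t) v0"
    using canon[of "cmp X (\<kappa> p ?t) v0" "cmp X (\<kappa> p ?s) w2"] w v pre
    by (simp_all add: c02_def s_e2)
  have c01: "vertical c01" "src X c01 = src X w0" "tgt X c01 = src X w1"
      "cmp X (cmp X (\<kappa> p ?s) w1) c01 = cmp X (\<kappa> p ?s) w0"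
    using canon[of "cmp X (\<kappa> p ?s) w0" "cmp X (\<kappa> p ?s) w1"] w v pre
    by (simp_all add: c01_def s_e1)
  have c12: "vertical c12" "src X c12 = src X v1" "tgt X c12 = src X v2"
      "cmp X (cmp X (\<kappa> p ?t) v2) c12 = cmp X (\<kappa> p ?t) v1"
    using canon[of "cmp X (\<kappa> p ?t) v1" "cmp X (\<kappa> p ?t) v2"] w v pre
    by (simp_all add: c12_def t_e1)
  define L R where "L = cmp X b2 (cmp X c02 b0)" and "R = cmp X c12 (cmp X b1 c01)"
  \<comment> \<open>The canonical isomorphisms move \<open>w1\<close> and \<open>w2\<close> to the
    source d0^*s^*p of \<open>w0\<close>; the factor \<open>b0\<close>, the pullback of \<phi>, is
    what makes \<open>x2\<close> start where \<open>w0\<close> ends.\<close>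
  define x1 x2 where "x1 = cmp X w1 c01" and "x2 = cmp X w2 (cmp X c02 b0)"
  have LR: "vertical L" "src X L = src X w0" "tgt X L = src X v2"
      "vertical R" "src X R = src X w0" "tgt X R = src X v2"
    using b c02 c01 c12 by (simp_all add: L_def R_def)
  have "cmp X (\<kappa> p ?s) x2 = cmp X (cmp X (cmp X (\<kappa> p ?s) w2) c02) b0"
    using w v pre b(1-3) c02(1-3) by (simp add: x2_def dom.assoc)
  also have "\<dots> = cmp X (\<kappa> p ?t) (cmp X v0 b0)"
    using w v pre b(1-3) c02 by (simp add: dom.assoc[of b0 v0])
  also have "\<dots> = cmp X (tleg p \<phi>) w0"
    using w v pre b by (simp add: dom.assoc)
  finally have triple: "is_triple (sleg p) (tleg p \<phi>) w0 x1 x2"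
    using w v pre b c02 c01
    by (simp add: is_triple_def x1_def x2_def dom.assoc[symmetric] del: far_cmp)
  have "cmp X (cmp X (\<kappa> p ?t) v2) L = cmp X (cmp X (\<kappa> p ?t) (cmp X v2 b2)) (cmp X c02 b0)"
    using w v pre b(1-3,9-11) c02(1-3) by (simp add: L_def dom.assoc)
  also have "\<dots> = cmp X (tleg p \<phi>) x2"
    using w v pre b(1-3) b(12) c02(1-3) by (simp add: x2_def dom.assoc)
  finally have L: "cmp X (cmp X (\<kappa> p ?t) v2) L = cmp X (tleg p \<phi>) x2" .
  have "cmp X (cmp X (\<kappa> p ?t) v2) R = cmp X (cmp X (cmp X (\<kappa> p ?t) v2) c12) (cmp X b1 c01)"
    using w v pre b(5-7) c01(1-3) c12(1-3) by (simp add: R_def dom.assoc)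
  also have "\<dots> = cmp X (cmp X (\<kappa> p ?t) (cmp X v1 b1)) c01"
    using w v pre b(5-7) c01(1-3) by (simp add: c12(4), simp add: dom.assoc)
  also have "\<dots> = cmp X (tleg p \<phi>) x1"
    using w v pre c01(1-3) by (simp add: b(8), simp add: x1_def dom.assoc)
  finally have R: "cmp X (cmp X (\<kappa> p ?t) v2) R = cmp X (tleg p \<phi>) x1" .
  \<comment> \<open>\<open>L\<close> and \<open>R\<close> have the same base image, so the lift of
    \<open>p\<close> over t composed with d2 can be cancelled.\<close>
  have "L = R \<longleftrightarrow> cmp X (tleg p \<phi>) x2 = cmp X (tleg p \<phi>) x1"
  proof
    assume "cmp X (tleg p \<phi>) x2 = cmp X (tleg p \<phi>) x1"
    with L R have "cmp X (cmp X (\<kappa> p ?t) v2) L = cmp X (cmp X (\<kappa> p ?t) v2) R" by simp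
    then show "L = R"
      using LR v pre by - (rule cartesian_cancel[of "cmp X (\<kappa> p ?t) v2"]; simp add: far_vertical)
  qed (use L R in simp)
  also have "\<dots> \<longleftrightarrow> cocycle_span (sleg p) (tleg p \<phi>)"
    using cocycle_spanI[OF precocycle_span[OF True] triple] triple
    unfolding cocycle_span_def by blast
  finally have "L = R \<longleftrightarrow> cocycle_span (sleg p) (tleg p \<phi>)" .
  moreover have "is_cocycle \<Gamma> X \<pi> \<kappa> (p, \<phi>) \<longleftrightarrow> L = R"
    using pre far_obj
    by (simp add: is_cocycle_def Let_def hom_fibre_iff pull_def Ob_fibre
        L_def R_def b0_def b1_def b2_def c02_def c01_def c12_def l_eq)
  ultimately show ?thesis
    using True by simp
qed

definition cocycle_hom :: "'o \<times> 'a \<Rightarrow> 'o \<times> 'a \<Rightarrow> 'a \<Rightarrow> bool" where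
  "cocycle_hom z z' \<alpha> \<longleftrightarrow> is_cocycle \<Gamma> X \<pi> \<kappa> z \<and> is_cocycle \<Gamma> X \<pi> \<kappa> z' \<and>
     span_hom (sleg (fst z)) (tleg (fst z) (snd z)) (sleg (fst z')) (tleg (fst z') (snd z')) \<alpha>"

lemma cocycle_hom_vertical:
  assumes "cocycle_hom z z' \<alpha>"
  shows "vertical \<alpha>" "src X \<alpha> = fst z" "tgt X \<alpha> = fst z'"
proof -
  have "precocycle (fst z) (snd z)" "precocycle (fst z') (snd z')"
    using assms is_cocycle_iff[of "fst z" "snd z"] is_cocycle_iff[of "fst z'" "snd z'"]
    by (auto simp: cocycle_hom_def)
  then show "vertical \<alpha>" "src X \<alpha> = fst z" "tgt X \<alpha> = fst z'"
    using assms by (auto simp: cocycle_hom_def span_hom_def precocycle_def)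
qed

text \<open>The apex arrow of a span morphism can only be s^*\<alpha>. With this choice, the square
  for the second leg is the defining equation of a cocycle morphism composed with the chosen arrow
  over t, which can be cancelled.\<close>

lemma cocycle_Ar_iff:
  "(z, \<alpha>, z') \<in> Ar (cocycle_cat \<Gamma> X \<pi> \<kappa>) \<longleftrightarrow> cocycle_hom z z' \<alpha>"
proof (cases "is_cocycle \<Gamma> X \<pi> \<kappa> z \<and> is_cocycle \<Gamma> X \<pi> \<kappa> z'")
  case False
  then show ?thesis by (cases z, cases z') (auto simp: cocycle_cat_def cocycle_hom_def)
next
  case True
  obtain p \<phi> p' \<phi>' where z: "z = (p, \<phi>)" "z' = (p', \<phi>')" by fastforce
  have pre: "precocycle p \<phi>" "precocycle p' \<phi>'"
    using True is_cocycle_iff by (auto simp: z)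
  note defs = pre[unfolded precocycle_def]
  note spans = pre[THEN precocycle_span]
  show ?thesis
  proof (cases "vertical \<alpha> \<and> src X \<alpha> = p \<and> tgt X \<alpha> = p'")
    case False
    then show ?thesis
      using defs cocycle_hom_vertical[of z z' \<alpha>] by (auto simp: z cocycle_cat_def hom_fibre_iff)
  next
    case \<alpha>: True
    let ?s = "pull_arr Man X \<pi> \<kappa> (s_arr \<Gamma>) \<alpha>" and ?t = "pull_arr Man X \<pi> \<kappa> (t_arr \<Gamma>) \<alpha>"
    have s: "vertical ?s" "src X ?s = src X (sleg p)" "tgt X ?s = src X (sleg p')"
        "cmp X (sleg p') ?s = cmp X \<alpha> (sleg p)"
      using pull_arr[of \<alpha> "s_arr \<Gamma>"] \<alpha> defs by auto
    have t: "vertical ?t" "src X ?t = src X (\<kappa> p (t_arr \<Gamma>))" "tgt X ?t = src X (\<kappa> p' (t_arr \<Gamma>))"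
        "cmp X (\<kappa> p' (t_arr \<Gamma>)) ?t = cmp X \<alpha> (\<kappa> p (t_arr \<Gamma>))"
      using pull_arr[of \<alpha> "t_arr \<Gamma>"] \<alpha> defs by auto
    have 1: "cmp X (tleg p' \<phi>') ?s = cmp X (\<kappa> p' (t_arr \<Gamma>)) (cmp X \<phi>' ?s)"
      using defs s(1-3) by (simp add: dom.assoc)
    have "cmp X \<alpha> (tleg p \<phi>) = cmp X (cmp X \<alpha> (\<kappa> p (t_arr \<Gamma>))) \<phi>"
      using defs \<alpha> by (simp add: dom.assoc)
    also have "\<dots> = cmp X (\<kappa> p' (t_arr \<Gamma>)) (cmp X ?t \<phi>)"
      using defs t(1-3) by (simp add: t(4)[symmetric] dom.assoc)
    finally have 2: "cmp X \<alpha> (tleg p \<phi>) = cmp X (\<kappa> p' (t_arr \<Gamma>)) (cmp X ?t \<phi>)" .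
    have unique: "u = ?s"
      if "vertical u" "src X u = src X (sleg p)" "tgt X u = src X (sleg p')"
        "cmp X (sleg p') u = cmp X \<alpha> (sleg p)" for u
      using that s defs by - (rule cartesian_cancel[of "sleg p'"]; simp add: far_vertical)
    have "span_hom (sleg p) (tleg p \<phi>) (sleg p') (tleg p' \<phi>') \<alpha> \<longleftrightarrow>
        cmp X (tleg p' \<phi>') ?s = cmp X \<alpha> (tleg p \<phi>)"
    proof
      assume "span_hom (sleg p) (tleg p \<phi>) (sleg p') (tleg p' \<phi>') \<alpha>"
      then show "cmp X (tleg p' \<phi>') ?s = cmp X \<alpha> (tleg p \<phi>)"
        unfolding span_hom_def using unique by metis
    next
      assume eq: "cmp X (tleg p' \<phi>') ?s = cmp X \<alpha> (tleg p \<phi>)"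
      show "span_hom (sleg p) (tleg p \<phi>) (sleg p') (tleg p' \<phi>') \<alpha>"
        unfolding span_hom_def
        by (intro conjI exI[of _ ?s]; (rule spans s eq)?) (use \<alpha> defs in simp_all)
    qed
    also have "\<dots> \<longleftrightarrow> cmp X \<phi>' ?s = cmp X ?t \<phi>"
      unfolding 1 2
    proof
      assume "cmp X (\<kappa> p' (t_arr \<Gamma>)) (cmp X \<phi>' ?s) = cmp X (\<kappa> p' (t_arr \<Gamma>)) (cmp X ?t \<phi>)"
      then show "cmp X \<phi>' ?s = cmp X ?t \<phi>"
        using defs s(1-3) t(1-3)
        by - (rule cartesian_cancel[of "\<kappa> p' (t_arr \<Gamma>)"]; simp add: far_vertical)
    qed simp
    finally show ?thesis
      using True \<alpha> defs by (auto simp: z cocycle_cat_def cocycle_hom_def hom_fibre_iff)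
  qed
qed

lemma cocycle_hom_cmp:
  "cocycle_hom z z' \<alpha> \<Longrightarrow> cocycle_hom z' z'' \<beta> \<Longrightarrow> cocycle_hom z z'' (cmp X \<beta> \<alpha>)"
  by (auto simp: cocycle_hom_def intro: span_hom_cmp)

lemma cocycle_hom_ide:
  assumes "is_cocycle \<Gamma> X \<pi> \<kappa> z"
  shows "cocycle_hom z z (ide X (fst z))"
proof -
  have "precocycle (fst z) (snd z)"
    using assms is_cocycle_iff[of "fst z" "snd z"] by simp
  then show ?thesis
    using assms
    by (auto simp: cocycle_hom_def precocycle_def intro!: span_hom_ide precocycle_span)
qed

lemma cocycle_cat_simps [simp]:
  "Ob (cocycle_cat \<Gamma> X \<pi> \<kappa>) = {z. is_cocycle \<Gamma> X \<pi> \<kappa> z}"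
  "src (cocycle_cat \<Gamma> X \<pi> \<kappa>) (z, \<alpha>, z') = z"
  "tgt (cocycle_cat \<Gamma> X \<pi> \<kappa>) (z, \<alpha>, z') = z'"
  "ide (cocycle_cat \<Gamma> X \<pi> \<kappa>) z = (z, ide X (fst z), z)"
  "cmp (cocycle_cat \<Gamma> X \<pi> \<kappa>) (z1, \<beta>, z2) (z, \<alpha>, z') = (z, cmp X \<beta> \<alpha>, z2)"
  by (auto simp: cocycle_cat_def case_prod_unfold)

lemma category_cocycle_cat: "is_category (cocycle_cat \<Gamma> X \<pi> \<kappa>)"
proof -
  note v = cocycle_hom_vertical
  have "is_cocycle \<Gamma> X \<pi> \<kappa> z \<and> is_cocycle \<Gamma> X \<pi> \<kappa> z'" if "cocycle_hom z z' \<alpha>" for z z' \<alpha>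
    using that by (simp add: cocycle_hom_def)
  moreover have "cmp X \<alpha> (ide X (fst z)) = \<alpha> \<and> cmp X (ide X (fst z')) \<alpha> = \<alpha>"
    if "cocycle_hom z z' \<alpha>" for z z' \<alpha>
    using v[OF that] by simp
  moreover have "cmp X \<gamma> (cmp X \<beta> \<alpha>) = cmp X (cmp X \<gamma> \<beta>) \<alpha>"
    if "cocycle_hom z z1 \<alpha>" "cocycle_hom z1 z2 \<beta>" "cocycle_hom z2 z3 \<gamma>" for z z1 z2 z3 \<alpha> \<beta> \<gamma>
    using v[OF that(1)] v[OF that(2)] v[OF that(3)] by (simp add: dom.assoc)
  ultimately show ?thesis
    unfolding is_category_def hom_def
    by (auto simp: cocycle_Ar_iff intro: cocycle_hom_cmp
        dest: cocycle_hom_ide)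
qed

text \<open>The cocycle category is a groupoid, so essential surjectivity requires only a morphism
  to the given cocycle.\<close>

lemma cocycle_cat_iso:
  assumes \<alpha>: "cocycle_hom z z' \<alpha>"
  shows "is_iso (cocycle_cat \<Gamma> X \<pi> \<kappa>) (z, \<alpha>, z')"
proof -
  note v = cocycle_hom_vertical[OF \<alpha>]
  obtain \<beta> where \<beta>: "vertical \<beta>" "src X \<beta> = tgt X \<alpha>" "tgt X \<beta> = src X \<alpha>"
      "cmp X \<alpha> \<beta> = ide X (tgt X \<alpha>)" "cmp X \<beta> \<alpha> = ide X (src X \<alpha>)"
    using vertical_inverse[OF v(1)] by metis
  have "cocycle_hom z' z \<beta>"
    using \<alpha> \<beta> by (auto simp: cocycle_hom_def intro: span_hom_inverse)
  then show ?thesis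
    unfolding is_iso_def
    by (intro conjI bexI[of _ "(z', \<beta>, z)"])
      (use \<alpha> \<beta> v in \<open>simp_all add: hom_def cocycle_Ar_iff\<close>)
qed

end

section \<open>The functor between cocycle categories\<close>

locale cocycle_functor =
  X: cocycles X \<pi>\<^sub>X \<kappa>\<^sub>X \<Gamma> + Y: cocycles Y \<pi>\<^sub>Y \<kappa>\<^sub>Y \<Gamma>
  for \<Gamma> :: "'m groupoid"
    and X :: "('o, 'a) cat" and \<pi>\<^sub>X :: "('o, 'a, 'm pt mfd, 'm man_arrow) func"
    and \<kappa>\<^sub>X :: "'o \<Rightarrow> 'm man_arrow \<Rightarrow> 'a"
    and Y :: "('p, 'b) cat" and \<pi>\<^sub>Y :: "('p, 'b, 'm pt mfd, 'm man_arrow) func"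
    and \<kappa>\<^sub>Y :: "'p \<Rightarrow> 'm man_arrow \<Rightarrow> 'b" +
  fixes F :: "('o, 'a, 'p, 'b) func"
  assumes morphism: "fibered_1_morphism Man X \<pi>\<^sub>X Y \<pi>\<^sub>Y F"
begin

sublocale F: cat_functor X Y F
  using morphism by unfold_locales (simp add: fibered_1_morphism_def)

lemma fob_F [simp]: "x \<in> Ob X \<Longrightarrow> fob \<pi>\<^sub>Y (fob F x) = fob \<pi>\<^sub>X x"
  and far_F [simp]: "a \<in> Ar X \<Longrightarrow> far \<pi>\<^sub>Y (far F a) = far \<pi>\<^sub>X a"
  using morphism by (simp_all add: fibered_1_morphism_def)

abbreviation F_ob :: "'o \<times> 'a \<Rightarrow> 'p \<times> 'b" where
  "F_ob \<equiv> cocycle_ob \<Gamma> \<kappa>\<^sub>X Y \<pi>\<^sub>Y \<kappa>\<^sub>Y F"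

abbreviation F_cat :: "('o \<times> 'a, ('o \<times> 'a) \<times> 'a \<times> ('o \<times> 'a), 'p \<times> 'b, ('p \<times> 'b) \<times> 'b \<times> ('p \<times> 'b)) func" where
  "F_cat \<equiv> cocycle_func \<Gamma> \<kappa>\<^sub>X Y \<pi>\<^sub>Y \<kappa>\<^sub>Y F"

lemma vertical_F: "X.vertical u \<Longrightarrow> Y.vertical (far F u)"
  by (simp add: X.vertical_def Y.vertical_def)

lemma is_span_F: "X.is_span \<sigma> \<rho> \<Longrightarrow> Y.is_span (far F \<sigma>) (far F \<rho>)"
  by (simp add: X.is_span_def Y.is_span_def)

lemma is_triple_F:
  assumes "X.is_span \<sigma> \<rho>" "X.is_triple \<sigma> \<rho> x0 x1 x2"
  shows "Y.is_triple (far F \<sigma>) (far F \<rho>) (far F x0) (far F x1) (far F x2)"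
  using assms by (simp add: X.is_span_def X.is_triple_def Y.is_triple_def F.far_cmp[symmetric] del: F.far_cmp)

text \<open>Triples in \<open>Y\<close> need not come from \<open>X\<close>, but one triple is
  enough, and the image of a triple in \<open>X\<close> provides it.\<close>

lemma cocycle_span_F:
  assumes "X.cocycle_span \<sigma> \<rho>"
  shows "Y.cocycle_span (far F \<sigma>) (far F \<rho>)"
proof -
  have sp: "X.is_span \<sigma> \<rho>" using assms by (simp add: X.cocycle_span_def)
  obtain x0 x1 x2 where x: "X.is_triple \<sigma> \<rho> x0 x1 x2"
    using X.ex_triple[OF sp] .
  have "cmp X \<rho> x2 = cmp X \<rho> x1"
    using assms x by (auto simp: X.cocycle_span_def)
  then have "cmp Y (far F \<rho>) (far F x2) = cmp Y (far F \<rho>) (far F x1)"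
    using sp x by (simp add: X.is_span_def X.is_triple_def F.far_cmp[symmetric] del: F.far_cmp)
  then show ?thesis
    by (rule Y.cocycle_spanI[OF is_span_F[OF sp] is_triple_F[OF sp x]])
qed

lemma cocycle_span_reflect:
  assumes ff: "faithful X F" and sp: "X.is_span \<sigma> \<rho>" and co: "Y.cocycle_span (far F \<sigma>) (far F \<rho>)"
  shows "X.cocycle_span \<sigma> \<rho>"
proof -
  obtain x0 x1 x2 where x: "X.is_triple \<sigma> \<rho> x0 x1 x2"
    using X.ex_triple[OF sp] .
  have "cmp Y (far F \<rho>) (far F x2) = cmp Y (far F \<rho>) (far F x1)"
    using co is_triple_F[OF sp x] by (auto simp: Y.cocycle_span_def)
  then have "cmp X \<rho> x2 = cmp X \<rho> x1"
    using sp x by - (rule faithfulD[OF ff]; simp add: X.is_span_def X.is_triple_def)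
  then show ?thesis
    by (rule X.cocycle_spanI[OF sp x])
qed

lemma span_hom_F:
  assumes "X.span_hom \<sigma> \<rho> \<sigma>' \<rho>' \<alpha>"
  shows "Y.span_hom (far F \<sigma>) (far F \<rho>) (far F \<sigma>') (far F \<rho>') (far F \<alpha>)"
proof -
  obtain u where u: "X.vertical u" "src X u = src X \<sigma>" "tgt X u = src X \<sigma>'"
      "cmp X \<sigma>' u = cmp X \<alpha> \<sigma>" "cmp X \<rho>' u = cmp X \<alpha> \<rho>"
    using assms by (auto simp: X.span_hom_def)
  note defs = assms[unfolded X.span_hom_def X.is_span_def]
  have "cmp Y (far F \<sigma>') (far F u) = cmp Y (far F \<alpha>) (far F \<sigma>)"
    "cmp Y (far F \<rho>') (far F u) = cmp Y (far F \<alpha>) (far F \<rho>)"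
    using defs u by (simp_all add: F.far_cmp[symmetric] del: F.far_cmp)
  then show ?thesis
    using assms u unfolding X.span_hom_def Y.span_hom_def
    by (auto simp: is_span_F vertical_F X.is_span_def intro!: exI[of _ "far F u"])
qed

text \<open>Fullness lifts the apex arrow, compatibility with the projections makes the lift
  vertical, and faithfulness lifts the two squares.\<close>

lemma span_hom_reflect:
  assumes ff: "faithful X F" "full X Y F"
    and sp: "X.is_span \<sigma> \<rho>" "X.is_span \<sigma>' \<rho>'"
    and \<alpha>: "X.vertical \<alpha>" "src X \<alpha> = tgt X \<sigma>" "tgt X \<alpha> = tgt X \<sigma>'"
    and h: "Y.span_hom (far F \<sigma>) (far F \<rho>) (far F \<sigma>') (far F \<rho>') (far F \<alpha>)"
  shows "X.span_hom \<sigma> \<rho> \<sigma>' \<rho>' \<alpha>"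
proof -
  note defs = sp[unfolded X.is_span_def]
  obtain v where v: "Y.vertical v" "src Y v = src Y (far F \<sigma>)" "tgt Y v = src Y (far F \<sigma>')"
      "cmp Y (far F \<sigma>') v = cmp Y (far F \<alpha>) (far F \<sigma>)" "cmp Y (far F \<rho>') v = cmp Y (far F \<alpha>) (far F \<rho>)"
    using h by (auto simp: Y.span_hom_def)
  obtain u where u: "u \<in> Ar X" "src X u = src X \<sigma>" "tgt X u = src X \<sigma>'" "far F u = v"
    by (rule fullE[OF ff(2), of "src X \<sigma>" "src X \<sigma>'" v]) (use v defs in auto)
  have "X.vertical u"
    using u v(1,2) far_F[OF u(1)] defs by (simp add: X.vertical_def Y.far_vertical)
  moreover have "cmp X \<sigma>' u = cmp X \<alpha> \<sigma>" "cmp X \<rho>' u = cmp X \<alpha> \<rho>"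
    by (rule faithfulD[OF ff(1)]; use u v \<alpha> defs in simp)+
  ultimately show ?thesis
    unfolding X.span_hom_def using sp \<alpha> u by auto
qed

text \<open>Replacing the pullbacks \<open>F\<close> produces by the chosen ones changes only the
  apex, through the comparison \<open>c\<close>. The comparison over the target map is absorbed into
  the second leg, so the morphism of spans lies over an identity.\<close>

lemma F_ob_span_hom:
  assumes pre: "X.precocycle p \<phi>" and q: "(q, \<psi>) = F_ob (p, \<phi>)"
  shows "q = fob F p" "Y.precocycle q \<psi>"
    "Y.span_hom (Y.sleg q) (Y.tleg q \<psi>) (far F (X.sleg p)) (far F (X.tleg p \<phi>)) (ide Y q)"
proof -
  let ?\<sigma> = "far F (\<kappa>\<^sub>X p (s_arr \<Gamma>))" and ?\<tau> = "far F (\<kappa>\<^sub>X p (t_arr \<Gamma>))"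
  note defs = pre[unfolded X.precocycle_def]
  define c c' where "c = canon Man Y \<pi>\<^sub>Y (Y.sleg q) ?\<sigma>"
    and "c' = canon Man Y \<pi>\<^sub>Y ?\<tau> (\<kappa>\<^sub>Y q (t_arr \<Gamma>))"
  show q_eq: "q = fob F p"
    using q by (simp add: cocycle_ob_def)
  have \<psi>: "\<psi> = cmp Y c' (cmp Y (far F \<phi>) c)"
    using q by (simp add: cocycle_ob_def c_def c'_def)
  have Fp: "fob F p \<in> Ob Y" "fob \<pi>\<^sub>Y (fob F p) = G0 \<Gamma>"
    using defs by auto
  have c: "Y.vertical c" "src Y c = src Y (Y.sleg q)" "tgt Y c = src Y ?\<sigma>" "cmp Y ?\<sigma> c = Y.sleg q"
    unfolding c_def by (rule Y.canon; use defs Fp q_eq in simp)+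
  have c': "Y.vertical c'" "src Y c' = src Y ?\<tau>" "tgt Y c' = src Y (\<kappa>\<^sub>Y q (t_arr \<Gamma>))"
      "cmp Y (\<kappa>\<^sub>Y q (t_arr \<Gamma>)) c' = ?\<tau>"
    unfolding c'_def by (rule Y.canon; use defs Fp q_eq in simp)+
  have F\<phi>: "Y.vertical (far F \<phi>)" "src Y (far F \<phi>) = src Y ?\<sigma>" "tgt Y (far F \<phi>) = src Y ?\<tau>"
    using defs vertical_F by auto
  show pre_q: "Y.precocycle q \<psi>"
    using Fp c(1-3) c'(1-3) F\<phi> by (simp add: Y.precocycle_def \<psi> q_eq)
  have "Y.tleg q \<psi> = cmp Y (cmp Y (\<kappa>\<^sub>Y q (t_arr \<Gamma>)) c') (cmp Y (far F \<phi>) c)"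
    using Fp c(1-3) c'(1-3) F\<phi> by (simp add: \<psi> q_eq Y.dom.assoc)
  also have "\<dots> = cmp Y (far F (X.tleg p \<phi>)) c"
    using defs c(1-3) F\<phi> by (simp add: c'(4) Y.dom.assoc)
  finally have tl: "Y.tleg q \<psi> = cmp Y (far F (X.tleg p \<phi>)) c" .
  have sp: "Y.is_span (Y.sleg q) (Y.tleg q \<psi>)" "Y.is_span ?\<sigma> (far F (X.tleg p \<phi>))"
    using Y.precocycle_span[OF pre_q] is_span_F[OF X.precocycle_span[OF pre]] by auto
  have "tgt Y (Y.sleg q) = q" "tgt Y (Y.tleg q \<psi>) = q"
    using pre_q sp(1) by (auto simp: Y.precocycle_def Y.is_span_def)
  then show "Y.span_hom (Y.sleg q) (Y.tleg q \<psi>) ?\<sigma> (far F (X.tleg p \<phi>)) (ide Y q)"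
    unfolding Y.span_hom_def
    using sp c tl Fp defs by (auto simp: q_eq[symmetric] Y.is_span_def intro!: exI[of _ c])
qed

lemma F_ob_span_hom':
  assumes pre: "X.precocycle p \<phi>" and q: "(q, \<psi>) = F_ob (p, \<phi>)"
  shows "Y.span_hom (far F (X.sleg p)) (far F (X.tleg p \<phi>)) (Y.sleg q) (Y.tleg q \<psi>) (ide Y q)"
proof -
  have "q \<in> Ob Y" using F_ob_span_hom(2)[OF assms] by (simp add: Y.precocycle_def)
  then show ?thesis
    by (intro Y.span_hom_inverse[OF F_ob_span_hom(3)[OF assms]]) auto
qed

lemma F_ob_cocycle:
  assumes "is_cocycle \<Gamma> X \<pi>\<^sub>X \<kappa>\<^sub>X z"
  shows "is_cocycle \<Gamma> Y \<pi>\<^sub>Y \<kappa>\<^sub>Y (F_ob z)"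
proof -
  obtain p \<phi> q \<psi> where z: "z = (p, \<phi>)" "(q, \<psi>) = F_ob (p, \<phi>)" by (metis surj_pair)
  have pre: "X.precocycle p \<phi>" "X.cocycle_span (X.sleg p) (X.tleg p \<phi>)"
    using assms by (simp_all add: z X.is_cocycle_iff)
  have "Y.cocycle_span (Y.sleg q) (Y.tleg q \<psi>)"
    by (rule Y.cocycle_span_transfer[OF F_ob_span_hom'[OF pre(1) z(2)] cocycle_span_F[OF pre(2)]])
  then show ?thesis
    using F_ob_span_hom(2)[OF pre(1) z(2)] by (simp add: z(1) z(2)[symmetric] Y.is_cocycle_iff)
qed

text \<open>The comparisons with the image spans go both ways over identities, so composing with
  them does not change \<beta>. Morphisms between induced cocycles can thus be tested without
  canonical isomorphisms.\<close>

lemma F_ob_hom_iff: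
  assumes "is_cocycle \<Gamma> X \<pi>\<^sub>X \<kappa>\<^sub>X (p, \<phi>)" "is_cocycle \<Gamma> X \<pi>\<^sub>X \<kappa>\<^sub>X (p', \<phi>')"
    and \<beta>: "\<beta> \<in> Ar Y" "src Y \<beta> = fob F p" "tgt Y \<beta> = fob F p'"
  shows "Y.cocycle_hom (F_ob (p, \<phi>)) (F_ob (p', \<phi>')) \<beta> \<longleftrightarrow>
    Y.span_hom (far F (X.sleg p)) (far F (X.tleg p \<phi>)) (far F (X.sleg p')) (far F (X.tleg p' \<phi>')) \<beta>"
proof -
  obtain q \<psi> q' \<psi>' where q: "(q, \<psi>) = F_ob (p, \<phi>)" "(q', \<psi>') = F_ob (p', \<phi>')" by (metis surj_pair)
  have pre: "X.precocycle p \<phi>" "X.precocycle p' \<phi>'"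
    using assms(1,2) by (simp_all add: X.is_cocycle_iff)
  note Q = F_ob_span_hom[OF pre(1) q(1)] F_ob_span_hom[OF pre(2) q(2)]
  note Q' = F_ob_span_hom'[OF pre(1) q(1)] F_ob_span_hom'[OF pre(2) q(2)]
  have \<beta>_ide: "cmp Y (ide Y q') (cmp Y \<beta> (ide Y q)) = \<beta>"
    using \<beta> Q(1,4) by simp
  have "Y.span_hom (Y.sleg q) (Y.tleg q \<psi>) (Y.sleg q') (Y.tleg q' \<psi>') \<beta> \<longleftrightarrow>
    Y.span_hom (far F (X.sleg p)) (far F (X.tleg p \<phi>)) (far F (X.sleg p')) (far F (X.tleg p' \<phi>')) \<beta>"
    using Y.span_hom_cmp[OF Y.span_hom_cmp[OF Q(3)] Q'(2), of \<beta>]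
      Y.span_hom_cmp[OF Y.span_hom_cmp[OF Q'(1)] Q(6), of \<beta>] \<beta>_ide by auto
  then show ?thesis
    using F_ob_cocycle[OF assms(1)] F_ob_cocycle[OF assms(2)]
    by (simp add: Y.cocycle_hom_def q[symmetric])
qed

lemma F_cat_hom:
  assumes "X.cocycle_hom z z' \<alpha>"
  shows "Y.cocycle_hom (F_ob z) (F_ob z') (far F \<alpha>)"
proof -
  note v = X.cocycle_hom_vertical[OF assms]
  have "Y.cocycle_hom (F_ob (fst z, snd z)) (F_ob (fst z', snd z')) (far F \<alpha>)"
    by (subst F_ob_hom_iff) (use assms v in \<open>auto simp: X.cocycle_hom_def span_hom_F\<close>)
  then show ?thesis by simp
qed

lemma F_cat_simps [simp]:
  "fob F_cat z = F_ob z" "far F_cat (z, \<alpha>, z') = (F_ob z, far F \<alpha>, F_ob z')"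
  by (simp_all add: cocycle_func_def)

lemma fst_F_ob [simp]: "fst (F_ob z) = fob F (fst z)"
  by (cases z) (simp add: cocycle_ob_def)

theorem functor_F_cat: "is_functor (cocycle_cat \<Gamma> X \<pi>\<^sub>X \<kappa>\<^sub>X) (cocycle_cat \<Gamma> Y \<pi>\<^sub>Y \<kappa>\<^sub>Y) F_cat"
proof -
  have "far F (ide X (fst z)) = ide Y (fob F (fst z))" if "is_cocycle \<Gamma> X \<pi>\<^sub>X \<kappa>\<^sub>X z" for z
    using that X.is_cocycle_iff[of "fst z" "snd z"] by (simp add: X.precocycle_def)
  moreover have "far F (cmp X \<beta> \<alpha>) = cmp Y (far F \<beta>) (far F \<alpha>)"
    if "X.cocycle_hom z z' \<alpha>" "X.cocycle_hom z' z'' \<beta>" for z z' z'' \<alpha> \<beta>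
    using X.cocycle_hom_vertical[OF that(1)] X.cocycle_hom_vertical[OF that(2)] by simp
  ultimately show ?thesis
    unfolding is_functor_def hom_def
    by (auto simp: X.category_cocycle_cat Y.category_cocycle_cat X.cocycle_Ar_iff Y.cocycle_Ar_iff
        F_ob_cocycle F_cat_hom)
qed

section \<open>Faithfulness, fullness and essential surjectivity of the induced functor\<close>

lemma faithful_F_cat:
  assumes ff: "faithful X F"
  shows "faithful (cocycle_cat \<Gamma> X \<pi>\<^sub>X \<kappa>\<^sub>X) F_cat"
proof -
  have "\<alpha> = \<beta>" if "X.cocycle_hom z z' \<alpha>" "X.cocycle_hom z z' \<beta>" "far F \<alpha> = far F \<beta>" for z z' \<alpha> \<beta>
    using X.cocycle_hom_vertical[OF that(1)] X.cocycle_hom_vertical[OF that(2)] that(3)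
    by - (rule faithfulD[OF ff]; simp)
  then show ?thesis
    by (auto simp: faithful_def X.cocycle_Ar_iff)
qed

lemma full_F_cat:
  assumes ff: "faithful X F" "full X Y F"
  shows "full (cocycle_cat \<Gamma> X \<pi>\<^sub>X \<kappa>\<^sub>X) (cocycle_cat \<Gamma> Y \<pi>\<^sub>Y \<kappa>\<^sub>Y) F_cat"
proof -
  have "\<exists>\<alpha>. X.cocycle_hom (p, \<phi>) (p', \<phi>') \<alpha> \<and> far F \<alpha> = \<beta>"
    if z: "is_cocycle \<Gamma> X \<pi>\<^sub>X \<kappa>\<^sub>X (p, \<phi>)" "is_cocycle \<Gamma> X \<pi>\<^sub>X \<kappa>\<^sub>X (p', \<phi>')"
      and \<beta>: "Y.cocycle_hom (F_ob (p, \<phi>)) (F_ob (p', \<phi>')) \<beta>" for p \<phi> p' \<phi>' \<beta>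
  proof -
    have v: "Y.vertical \<beta>" "src Y \<beta> = fob F p" "tgt Y \<beta> = fob F p'"
      using Y.cocycle_hom_vertical[OF \<beta>] by auto
    have pre: "X.precocycle p \<phi>" "X.precocycle p' \<phi>'"
      using z by (simp_all add: X.is_cocycle_iff)
    note defs = pre[unfolded X.precocycle_def]
    obtain \<alpha> where \<alpha>: "\<alpha> \<in> Ar X" "src X \<alpha> = p" "tgt X \<alpha> = p'" "far F \<alpha> = \<beta>"
      by (rule fullE[OF ff(2), of p p' \<beta>]) (use v defs in auto)
    have "X.vertical \<alpha>"
      using \<alpha> v(1,2) far_F[OF \<alpha>(1)] defs by (simp add: X.vertical_def Y.far_vertical)
    moreover have "Y.span_hom (far F (X.sleg p)) (far F (X.tleg p \<phi>)) (far F (X.sleg p'))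
        (far F (X.tleg p' \<phi>')) (far F \<alpha>)"
      using \<beta> F_ob_hom_iff[OF z] v \<alpha> by simp
    ultimately have "X.span_hom (X.sleg p) (X.tleg p \<phi>) (X.sleg p') (X.tleg p' \<phi>') \<alpha>"
      using \<alpha> defs by (intro span_hom_reflect[OF ff pre[THEN X.precocycle_span]]) auto
    then show ?thesis
      using z \<alpha> by (auto simp: X.cocycle_hom_def)
  qed
  then show ?thesis
    by (fastforce simp: full_def hom_def X.cocycle_Ar_iff Y.cocycle_Ar_iff)
qed

text \<open>The isomorphism \<open>F x \<cong> q\<close> need not be vertical; pulling \<open>x\<close> back along its image in
  \<^const>\<open>Man\<close> makes it so.\<close>

lemma vertical_ess_surj:
  assumes es: "ess_surj X Y F" and q: "q \<in> Ob Y"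
  obtains p \<beta> where "p \<in> Ob X" "Y.vertical \<beta>" "src Y \<beta> = fob F p" "tgt Y \<beta> = q"
proof -
  obtain x e where x: "x \<in> Ob X" and e: "e \<in> Ar Y" "src Y e = fob F x" "tgt Y e = q" "is_iso Y e"
    using es q by (fastforce simp: ess_surj_def hom_def)
  obtain i where i: "i \<in> Ar Y" "src Y i = q" "tgt Y i = fob F x" "cmp Y e i = ide Y q"
    by (rule Y.dom.is_isoE[OF e(4)]) (use e in auto)
  obtain a where a: "a \<in> Ar X" "tgt X a = x" "far \<pi>\<^sub>X a = far \<pi>\<^sub>Y i"
    by (rule X.lift[of x "far \<pi>\<^sub>Y i"]) (use x i in auto)
  have src_a: "fob \<pi>\<^sub>X (src X a) = fob \<pi>\<^sub>Y q"
    using X.src_far[OF a(1)] Y.src_far[OF i(1)] a i by simp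
  \<comment> \<open>\<open>far F a\<close> and \<open>i\<close> have the same base image, and
    \<open>cmp Y e i\<close> is an identity; so the new arrow to \<open>q\<close> lies over an
    identity.\<close>
  have "far \<pi>\<^sub>Y (cmp Y e (far F a)) = far \<pi>\<^sub>Y (cmp Y e i)"
    using a e i(1-3) by simp
  then have "Y.vertical (cmp Y e (far F a))"
    using a e i q src_a by (simp add: Y.vertical_def)
  then show thesis
    using that[of "src X a" "cmp Y e (far F a)"] a e by simp
qed

text \<open>The span of the given cocycle is transported to one over \<open>fob F p\<close> whose
  first leg is the image of the chosen one. Fullness lifts the second leg, faithfulness reflects the
  cocycle condition, and \<phi> is read off from the lifted leg.\<close>

lemma ess_surj_F_cat:
  assumes ff: "faithful X F" "full X Y F" and es: "ess_surj X Y F"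
  shows "ess_surj (cocycle_cat \<Gamma> X \<pi>\<^sub>X \<kappa>\<^sub>X) (cocycle_cat \<Gamma> Y \<pi>\<^sub>Y \<kappa>\<^sub>Y) F_cat"
proof -
  have "\<exists>z \<beta>. is_cocycle \<Gamma> X \<pi>\<^sub>X \<kappa>\<^sub>X z \<and> Y.cocycle_hom (F_ob z) (q, \<psi>) \<beta>"
    if q: "is_cocycle \<Gamma> Y \<pi>\<^sub>Y \<kappa>\<^sub>Y (q, \<psi>)" for q \<psi>
  proof -
    have pre: "Y.precocycle q \<psi>" and co: "Y.cocycle_span (Y.sleg q) (Y.tleg q \<psi>)"
      using q by (simp_all add: Y.is_cocycle_iff)
    note q_defs = pre[unfolded Y.precocycle_def]
    have q_span: "Y.is_span (Y.sleg q) (Y.tleg q \<psi>)" by (rule Y.precocycle_span[OF pre])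
    note q_span' = q_span[unfolded Y.is_span_def]
    obtain p \<beta> where p: "p \<in> Ob X" and \<beta>: "Y.vertical \<beta>" "src Y \<beta> = fob F p" "tgt Y \<beta> = q"
      by (rule vertical_ess_surj[OF es, of q]) (use q_defs in auto)
    have far_p: "fob \<pi>\<^sub>X p = G0 \<Gamma>"
      using Y.fob_tgt_vertical[OF \<beta>(1)] \<beta> p q_defs by simp
    define \<sigma> where "\<sigma> = X.sleg p"
    have \<sigma>: "\<sigma> \<in> Ar X" "tgt X \<sigma> = p" "far \<pi>\<^sub>X \<sigma> = s_arr \<Gamma>" "fob \<pi>\<^sub>X (src X \<sigma>) = G1 \<Gamma>"
      using p far_p by (simp_all add: \<sigma>_def)
    define u where "u = canon Man Y \<pi>\<^sub>Y (cmp Y \<beta> (far F \<sigma>)) (Y.sleg q)"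
    have far_\<beta>\<sigma>: "far \<pi>\<^sub>Y (cmp Y \<beta> (far F \<sigma>)) = s_arr \<Gamma>"
      using \<sigma> \<beta> by (simp del: Y.far_cmp)
    have u: "Y.vertical u" "src Y u = fob F (src X \<sigma>)" "tgt Y u = src Y (Y.sleg q)"
        "cmp Y (Y.sleg q) u = cmp Y \<beta> (far F \<sigma>)"
      using Y.canon[of "cmp Y \<beta> (far F \<sigma>)" "Y.sleg q"] \<sigma> \<beta> q_span' q_defs far_\<beta>\<sigma>
      by (simp_all add: u_def)
    have far_tu: "far \<pi>\<^sub>Y (cmp Y (Y.tleg q \<psi>) u) = t_arr \<Gamma>"
      using u q_span' by (simp del: Y.far_cmp)
    \<comment> \<open>The transported second leg: the inverse of \<beta> after
      \<open>cmp Y (Y.tleg q \<psi>) u\<close>, obtained as a factorisation through \<beta> so that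
      its base image is prescribed.\<close>
    obtain r where r: "r \<in> Ar Y" "src Y r = fob F (src X \<sigma>)" "tgt Y r = fob F p"
        "far \<pi>\<^sub>Y r = t_arr \<Gamma>" "cmp Y \<beta> r = cmp Y (Y.tleg q \<psi>) u"
    proof (rule Y.cartesian[of "cmp Y (Y.tleg q \<psi>) u" \<beta> "t_arr \<Gamma>"])
      show "cmp Man (far \<pi>\<^sub>Y \<beta>) (t_arr \<Gamma>) = far \<pi>\<^sub>Y (cmp Y (Y.tleg q \<psi>) u)"
        using far_tu \<beta> p far_p by (simp add: Y.far_vertical)
    qed (use u \<beta> q_span' q_defs \<sigma> p far_p in simp_all)
    obtain \<rho> where \<rho>: "\<rho> \<in> Ar X" "src X \<rho> = src X \<sigma>" "tgt X \<rho> = p" "far F \<rho> = r"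
      by (rule fullE[OF ff(2), of "src X \<sigma>" p r]) (use r p \<sigma> in auto)
    have far_\<rho>: "far \<pi>\<^sub>X \<rho> = t_arr \<Gamma>"
      using far_F[OF \<rho>(1)] \<rho>(4) r by simp
    define \<phi> where "\<phi> = canon Man X \<pi>\<^sub>X \<rho> (\<kappa>\<^sub>X p (t_arr \<Gamma>))"
    have \<phi>: "X.vertical \<phi>" "src X \<phi> = src X \<sigma>" "tgt X \<phi> = src X (\<kappa>\<^sub>X p (t_arr \<Gamma>))"
        "X.tleg p \<phi> = \<rho>"
      using X.canon[of \<rho> "\<kappa>\<^sub>X p (t_arr \<Gamma>)"] \<rho> far_\<rho> p far_p by (simp_all add: \<phi>_def)
    have pre_p: "X.precocycle p \<phi>"
      using \<phi> p far_p by (simp add: X.precocycle_def \<sigma>_def)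
    have span: "X.is_span \<sigma> \<rho>"
      using \<sigma> \<rho> far_\<rho> by (simp add: X.is_span_def)
    have hom: "Y.span_hom (far F \<sigma>) (far F \<rho>) (Y.sleg q) (Y.tleg q \<psi>) \<beta>"
      unfolding Y.span_hom_def
      using is_span_F[OF span] q_span \<beta> \<sigma> u r \<rho> q_defs by (auto intro!: exI[of _ u])
    \<comment> \<open>The cocycle condition is known for \<open>q\<close> and travels along
      morphisms, so the morphism over \<beta> has to be reversed.\<close>
    obtain \<gamma> where \<gamma>: "Y.vertical \<gamma>" "src Y \<gamma> = q" "tgt Y \<gamma> = fob F p" "cmp Y \<gamma> \<beta> = ide Y (fob F p)"
      using Y.vertical_inverse[OF \<beta>(1)] \<beta> by metis
    have "Y.span_hom (Y.sleg q) (Y.tleg q \<psi>) (far F \<sigma>) (far F \<rho>) \<gamma>"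
      by (rule Y.span_hom_inverse[OF hom]) (use \<beta> \<gamma> in simp_all)
    then have "Y.cocycle_span (far F \<sigma>) (far F \<rho>)"
      using Y.cocycle_span_transfer co by blast
    then have "X.cocycle_span \<sigma> \<rho>"
      by (rule cocycle_span_reflect[OF ff(1) span])
    then have z: "is_cocycle \<Gamma> X \<pi>\<^sub>X \<kappa>\<^sub>X (p, \<phi>)"
      using pre_p \<phi>(4) by (simp add: X.is_cocycle_iff \<sigma>_def)
    obtain q' \<psi>' where q': "(q', \<psi>') = F_ob (p, \<phi>)" by (metis surj_pair)
    have "Y.span_hom (Y.sleg q') (Y.tleg q' \<psi>') (Y.sleg q) (Y.tleg q \<psi>) (cmp Y \<beta> (ide Y q'))"
      using Y.span_hom_cmp[OF F_ob_span_hom(3)[OF pre_p q']] hom \<phi>(4) by (simp add: \<sigma>_def)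
    then have "Y.cocycle_hom (F_ob (p, \<phi>)) (q, \<psi>) (cmp Y \<beta> (ide Y q'))"
      using F_ob_cocycle[OF z] q by (simp add: Y.cocycle_hom_def q'[symmetric])
    with z show ?thesis by blast
  qed
  then have *: "\<exists>z \<beta>. is_cocycle \<Gamma> X \<pi>\<^sub>X \<kappa>\<^sub>X z \<and> Y.cocycle_hom (F_ob z) y \<beta>"
    if "is_cocycle \<Gamma> Y \<pi>\<^sub>Y \<kappa>\<^sub>Y y" for y
    using that by (cases y) blast
  show ?thesis
    unfolding ess_surj_def
  proof
    fix y assume "y \<in> Ob (cocycle_cat \<Gamma> Y \<pi>\<^sub>Y \<kappa>\<^sub>Y)"
    then obtain z \<beta> where z: "is_cocycle \<Gamma> X \<pi>\<^sub>X \<kappa>\<^sub>X z" "Y.cocycle_hom (F_ob z) y \<beta>"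
      using *[of y] by (auto simp del: split_paired_Ex)
    show "\<exists>x \<in> Ob (cocycle_cat \<Gamma> X \<pi>\<^sub>X \<kappa>\<^sub>X). \<exists>e \<in> hom (cocycle_cat \<Gamma> Y \<pi>\<^sub>Y \<kappa>\<^sub>Y) (fob F_cat x) y.
        is_iso (cocycle_cat \<Gamma> Y \<pi>\<^sub>Y \<kappa>\<^sub>Y) e"
      by (intro bexI[of _ z] bexI[of _ "(F_ob z, \<beta>, y)"])
        (use z Y.cocycle_cat_iso[OF z(2)] in \<open>simp_all add: hom_def Y.cocycle_Ar_iff\<close>)
  qed
qed

end

theorem proposition6p8:
  fixes \<Gamma> :: "'m groupoid"
    and X :: "('o, 'a) cat" and \<pi>\<^sub>X :: "('o, 'a, 'm pt mfd, 'm man_arrow) func"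
    and Y :: "('p, 'b) cat" and \<pi>\<^sub>Y :: "('p, 'b, 'm pt mfd, 'm man_arrow) func"
    and \<kappa>\<^sub>X :: "'o \<Rightarrow> 'm man_arrow \<Rightarrow> 'a" and \<kappa>\<^sub>Y :: "'p \<Rightarrow> 'm man_arrow \<Rightarrow> 'b"
    and F :: "('o, 'a, 'p, 'b) func"
  assumes "lie_groupoid \<Gamma>"
    and "fibered_in_groupoids Man X \<pi>\<^sub>X" and "is_cleavage Man X \<pi>\<^sub>X \<kappa>\<^sub>X"
    and "fibered_in_groupoids Man Y \<pi>\<^sub>Y" and "is_cleavage Man Y \<pi>\<^sub>Y \<kappa>\<^sub>Y"
    and "fibered_1_morphism Man X \<pi>\<^sub>X Y \<pi>\<^sub>Y F"
  shows "is_functor (cocycle_cat \<Gamma> X \<pi>\<^sub>X \<kappa>\<^sub>X) (cocycle_cat \<Gamma> Y \<pi>\<^sub>Y \<kappa>\<^sub>Y)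
           (cocycle_func \<Gamma> \<kappa>\<^sub>X Y \<pi>\<^sub>Y \<kappa>\<^sub>Y F) \<and>
         (is_equivalence X Y F \<longrightarrow>
            is_equivalence (cocycle_cat \<Gamma> X \<pi>\<^sub>X \<kappa>\<^sub>X) (cocycle_cat \<Gamma> Y \<pi>\<^sub>Y \<kappa>\<^sub>Y)
              (cocycle_func \<Gamma> \<kappa>\<^sub>X Y \<pi>\<^sub>Y \<kappa>\<^sub>Y F))"
proof -
  interpret cocycle_functor \<Gamma> X \<pi>\<^sub>X \<kappa>\<^sub>X Y \<pi>\<^sub>Y \<kappa>\<^sub>Y F
    using assms by unfold_locales
  interpret F_cat: cat_functor "cocycle_cat \<Gamma> X \<pi>\<^sub>X \<kappa>\<^sub>X" "cocycle_cat \<Gamma> Y \<pi>\<^sub>Y \<kappa>\<^sub>Y" F_cat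
    by unfold_locales (rule functor_F_cat)
  have "is_equivalence (cocycle_cat \<Gamma> X \<pi>\<^sub>X \<kappa>\<^sub>X) (cocycle_cat \<Gamma> Y \<pi>\<^sub>Y \<kappa>\<^sub>Y) F_cat"
    if "is_equivalence X Y F"
  proof -
    note eq = equivalence_imp_faithful[OF that] equivalence_imp_full[OF that]
      equivalence_imp_ess_surj[OF that]
    show ?thesis
      using F_cat.fully_faithful_ess_surj_imp_equivalence
        faithful_F_cat[OF eq(1)] full_F_cat[OF eq(1,2)] ess_surj_F_cat[OF eq] by blast
  qed
  then show ?thesis using functor_F_cat by blast
qed

end
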